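(* Let $A$ and $B$ be bialgebras over a field $k$. Then there exist a coalgebra $\mathcal{C}(B,A)$ (the universal covering coalgebra) and a partial covering $\Omega\colon B\otimes\mathcal{C}(B,A)\to A$ (the universal partial covering) with the following universal property: if $C$ is any $k$-coalgebra and $f\colon B\otimes C\to A$ is any partial covering, then there exists a unique coalgebra map $F\colon C\to\mathcal{C}(B,A)$ such that $f=\Omega\circ(\mathrm{id}_B\otimes F)$.
   Context: Let $A,B$ be bialgebras and $C$ a coalgebra over the field $k$. A linear map $f\colon B\otimes C\to A$ is a measuring if for all $b,b'\in B$, $c\in C$: $f(bb'\otimes c)=\sum_{(c)}f(b\otimes c_1)f(b'\otimes c_2)$ and $f(1\otimes c)=\varepsilon(c)1_A$. A partial covering is a measuring $f\colon B\otimes C\to A$ that is also a coalgebra map, where $B\otimes C$ has the tensor product coalgebra structure. Sweedler notation $\Delta(c)=\sum_{(c)}c_1\otimes c_2$ is used. *)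

theory Defs
  imports Complex_Main "HOL-Library.FuncSet" "HOL-Library.Function_Algebras"
begin

section \<open>Vector spaces with a carrier\<close>

text \<open>
  A vector space over the field \<open>'k\<close> is a linear subspace \<open>carr V\<close> of an ambient type
  that is a vector space under \<open>smul V\<close>. Carriers are needed because the
  universal covering coalgebra depends on the bialgebras and so cannot be a type of its own.
\<close>

record ('k, 'v) vspace =
  carr :: "'v set"
  smul :: "'k \<Rightarrow> 'v \<Rightarrow> 'v"

definition is_vspace :: "('k::field, 'v::ab_group_add, 'm) vspace_scheme \<Rightarrow> bool" where
  "is_vspace V \<longleftrightarrow> vector_space (smul V) \<and> module.subspace (smul V) (carr V)"

definition linear_map ::
  "('k::field, 'v::ab_group_add, 'm) vspace_scheme \<Rightarrow> ('k, 'w::ab_group_add, 'n) vspace_scheme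
    \<Rightarrow> ('v \<Rightarrow> 'w) \<Rightarrow> bool" where
  "linear_map V W f \<longleftrightarrow>
     (\<forall>x\<in>carr V. f x \<in> carr W) \<and>
     (\<forall>x\<in>carr V. \<forall>y\<in>carr V. f (x + y) = f x + f y) \<and>
     (\<forall>r. \<forall>x\<in>carr V. f (smul V r x) = smul W r (f x))"

definition bilinear_map ::
  "('k::field, 'v::ab_group_add, 'm) vspace_scheme \<Rightarrow> ('k, 'w::ab_group_add, 'n) vspace_scheme
    \<Rightarrow> ('k, 'u::ab_group_add, 'o) vspace_scheme \<Rightarrow> ('v \<Rightarrow> 'w \<Rightarrow> 'u) \<Rightarrow> bool" where
  "bilinear_map V W U \<beta> \<longleftrightarrow>
     (\<forall>v\<in>carr V. linear_map W U (\<beta> v)) \<and> (\<forall>w\<in>carr W. linear_map V U (\<lambda>v. \<beta> v w))"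

definition base_field :: "('k::field, 'k) vspace" where
  "base_field = \<lparr>carr = UNIV, smul = (*)\<rparr>"

definition dual :: "('k::field, 'v::ab_group_add, 'm) vspace_scheme \<Rightarrow> ('v \<Rightarrow> 'k) set" where
  "dual V = {\<phi>. linear_map V base_field \<phi>}"


section \<open>Tensor products\<close>

text \<open>
  Over a field the canonical map from \<open>V \<otimes> W\<close> to the bilinear forms on
  \<open>V\<^sup>* \<times> W\<^sup>*\<close>, sending \<open>v \<otimes> w\<close> to \<open>(\<phi>, \<psi>) \<mapsto> \<phi> v * \<psi> w\<close>, is injective. The tensor product
  is realised as its image. Theorem \<open>tensor_universal\<close> below shows that this has the
  universal property defining the tensor product.
\<close>

type_synonym ('k, 'v, 'w) tensor = "('v \<Rightarrow> 'k) \<times> ('w \<Rightarrow> 'k) \<Rightarrow> 'k"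

definition pointwise_smul :: "'k::field \<Rightarrow> ('x \<Rightarrow> 'k) \<Rightarrow> 'x \<Rightarrow> 'k" where
  "pointwise_smul r u = (\<lambda>x. r * u x)"

definition tens ::
  "('k::field, 'v::ab_group_add, 'm) vspace_scheme \<Rightarrow> ('k, 'w::ab_group_add, 'n) vspace_scheme
    \<Rightarrow> 'v \<Rightarrow> 'w \<Rightarrow> ('k, 'v, 'w) tensor" where
  "tens V W v w = (\<lambda>(\<phi>, \<psi>). if \<phi> \<in> dual V \<and> \<psi> \<in> dual W then \<phi> v * \<psi> w else 0)"

definition tensor_space ::
  "('k::field, 'v::ab_group_add, 'm) vspace_scheme \<Rightarrow> ('k, 'w::ab_group_add, 'n) vspace_scheme
    \<Rightarrow> ('k, ('k, 'v, 'w) tensor) vspace" where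
  "tensor_space V W =
     \<lparr>carr = module.span pointwise_smul {tens V W v w | v w. v \<in> carr V \<and> w \<in> carr W},
      smul = pointwise_smul\<rparr>"

text \<open>
  \<open>tensor_lift V W \<beta>\<close> is the linear map on \<open>V \<otimes> W\<close> induced by a bilinear map \<open>\<beta>\<close>. Applied to
  \<open>\<Delta> c\<close> it is the Sweedler sum \<open>\<Sum>\<^sub>(\<^sub>c\<^sub>) \<beta> c\<^sub>1 c\<^sub>2\<close>.
\<close>

definition tensor_lift ::
  "('k::field, 'v::ab_group_add, 'm) vspace_scheme \<Rightarrow> ('k, 'w::ab_group_add, 'n) vspace_scheme
    \<Rightarrow> ('v \<Rightarrow> 'w \<Rightarrow> 'u::ab_group_add) \<Rightarrow> ('k, 'v, 'w) tensor \<Rightarrow> 'u" where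
  "tensor_lift V W \<beta> t =
     (THE x. \<exists>ps. set ps \<subseteq> carr V \<times> carr W \<and> t = (\<Sum>(v, w)\<leftarrow>ps. tens V W v w) \<and>
                  x = (\<Sum>(v, w)\<leftarrow>ps. \<beta> v w))"

lemma linear_mapD:
  assumes "linear_map V W f" "x \<in> carr V"
  shows "f x \<in> carr W" "y \<in> carr V \<Longrightarrow> f (x + y) = f x + f y" "f (smul V r x) = smul W r (f x)"
  using assms by (auto simp: linear_map_def)

lemma bilinear_mapD:
  assumes "bilinear_map V W U \<beta>"
  shows "v \<in> carr V \<Longrightarrow> linear_map W U (\<beta> v)" "w \<in> carr W \<Longrightarrow> linear_map V U (\<lambda>v. \<beta> v w)"
  using assms by (auto simp: bilinear_map_def)

lemma is_vspaceD:
  assumes "is_vspace V"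
  shows "vector_space (smul V)" "0 \<in> carr V" "x \<in> carr V \<Longrightarrow> smul V r x \<in> carr V"
    "x \<in> carr V \<Longrightarrow> y \<in> carr V \<Longrightarrow> x + y \<in> carr V"
proof -
  interpret vector_space "smul V" using assms by (simp add: is_vspace_def)
  have S: "subspace (carr V)" using assms by (simp add: is_vspace_def)
  show "vector_space (smul V)" "0 \<in> carr V" "x \<in> carr V \<Longrightarrow> smul V r x \<in> carr V"
    "x \<in> carr V \<Longrightarrow> y \<in> carr V \<Longrightarrow> x + y \<in> carr V"
    using S subspace_0 subspace_scale subspace_add vector_space_axioms by auto
qed

lemma linear_map_0:
  assumes "is_vspace V" "linear_map V W f"
  shows "f 0 = 0"
proof -
  have "f (0 + 0) = f 0 + f 0"
    using assms is_vspaceD(2)[OF assms(1)] by (metis linear_mapD(2))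
  thus ?thesis by simp
qed

lemma linear_map_sum_list:
  assumes V: "is_vspace V" and f: "linear_map V W f"
    and "\<And>x. x \<in> set xs \<Longrightarrow> g x \<in> carr V"
  shows "(\<Sum>x\<leftarrow>xs. g x) \<in> carr V \<and> f (\<Sum>x\<leftarrow>xs. g x) = (\<Sum>x\<leftarrow>xs. f (g x))"
  using assms(3)
proof (induction xs)
  case Nil thus ?case using linear_map_0[OF V f] is_vspaceD(2)[OF V] by simp
next
  case (Cons x xs)
  thus ?case using is_vspaceD(4)[OF V] linear_mapD(2)[OF f] by auto
qed

lemma is_vspace_base_field: "is_vspace (base_field :: ('k::field, 'k) vspace)"
proof -
  interpret vector_space "(*) :: 'k \<Rightarrow> 'k \<Rightarrow> 'k" by unfold_locales (auto simp: algebra_simps)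
  show ?thesis using vector_space_axioms by (simp add: is_vspace_def base_field_def)
qed

lemma vector_space_pointwise: "vector_space (pointwise_smul :: 'k::field \<Rightarrow> ('x \<Rightarrow> 'k) \<Rightarrow> _)"
  by unfold_locales (auto simp: pointwise_smul_def fun_eq_iff algebra_simps)

lemma is_vspace_tensor_space:
  fixes V :: "('k::field, 'v::ab_group_add, 'm) vspace_scheme"
    and W :: "('k, 'w::ab_group_add, 'n) vspace_scheme"
  shows "is_vspace (tensor_space V W)"
proof -
  interpret vector_space "pointwise_smul :: 'k \<Rightarrow> (('v \<Rightarrow> 'k) \<times> ('w \<Rightarrow> 'k) \<Rightarrow> 'k) \<Rightarrow> _"
    by (rule vector_space_pointwise)
  show ?thesis by (simp add: is_vspace_def tensor_space_def vector_space_pointwise)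
qed

lemma separating_functional:
  fixes V :: "('k::field, 'v::ab_group_add, 'm) vspace_scheme"
  assumes V: "is_vspace V" and w: "w \<notin> module.span (smul V) S"
  shows "\<exists>\<psi>\<in>dual V. \<psi> w = 1 \<and> (\<forall>x\<in>S. \<psi> x = 0)"
proof -
  interpret V: vector_space "smul V" using V by (simp add: is_vspace_def)
  interpret K: vector_space "(*) :: 'k \<Rightarrow> 'k \<Rightarrow> 'k" by unfold_locales (auto simp: algebra_simps)
  interpret P: vector_space_pair "smul V" "(*) :: 'k \<Rightarrow> 'k \<Rightarrow> 'k" ..
  obtain Bs where Bs: "Bs \<subseteq> S" "V.independent Bs" "S \<subseteq> V.span Bs"
    using V.maximal_independent_subset by blast
  have wB: "w \<notin> V.span Bs" using w Bs(1) V.span_mono by blast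
  hence ind: "V.independent (insert w Bs)" using Bs(2) V.independent_insertI by blast
  obtain g where g: "Vector_Spaces.linear (smul V) (*) g"
      "\<forall>x\<in>insert w Bs. g x = (if x = w then 1 else 0)"
    using P.linear_independent_extend[OF ind, of "\<lambda>x. if x = w then 1 else 0"] by blast
  interpret g: Vector_Spaces.linear "smul V" "(*)" g by (rule g(1))
  have wn: "w \<notin> Bs" using wB V.span_base by blast
  have "\<forall>x\<in>V.span Bs. g x = 0"
    using g(2) wn by (metis insertCI g.eq_0_on_span)
  moreover have "g \<in> dual V"
    by (auto simp: dual_def linear_map_def base_field_def g.add g.scale)
  ultimately show ?thesis using g(2) Bs(3) by (intro bexI[of _ g]) auto
qed

lemma bilinear_map_tens:
  fixes V :: "('k::field, 'v::ab_group_add, 'm) vspace_scheme"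
    and W :: "('k, 'w::ab_group_add, 'n) vspace_scheme"
  assumes "is_vspace V" "is_vspace W"
  shows "bilinear_map V W (tensor_space V W) (tens V W)"
proof -
  interpret T: vector_space "pointwise_smul :: 'k \<Rightarrow> (('v \<Rightarrow> 'k) \<times> ('w \<Rightarrow> 'k) \<Rightarrow> 'k) \<Rightarrow> _"
    by (rule vector_space_pointwise)
  have mem: "tens V W v w \<in> carr (tensor_space V W)" if "v \<in> carr V" "w \<in> carr W" for v w
    using that by (auto simp: tensor_space_def intro!: T.span_base)
  have "tens V W (v + v') w = tens V W v w + tens V W v' w"
    "tens V W (smul V r v) w = pointwise_smul r (tens V W v w)"
    if "v \<in> carr V" "v' \<in> carr V" for v v' w r
    using that by (auto simp: tens_def fun_eq_iff pointwise_smul_def algebra_simps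
        dual_def linear_map_def base_field_def)
  moreover have "tens V W v (w + w') = tens V W v w + tens V W v w'"
    "tens V W v (smul W r w) = pointwise_smul r (tens V W v w)"
    if "w \<in> carr W" "w' \<in> carr W" for v w w' r
    using that by (auto simp: tens_def fun_eq_iff pointwise_smul_def algebra_simps
        dual_def linear_map_def base_field_def)
  moreover have "smul (tensor_space V W) = pointwise_smul" by (simp add: tensor_space_def)
  ultimately show ?thesis
    using mem by (simp add: bilinear_map_def linear_map_def)
qed

lemma sum_tens_eq_0:
  fixes V :: "('k::field, 'v::ab_group_add, 'm) vspace_scheme"
    and W :: "('k, 'w::ab_group_add, 'n) vspace_scheme"
  assumes V: "is_vspace V" and W: "is_vspace W" and U: "is_vspace U"
    and \<beta>: "bilinear_map V W U \<beta>"
  shows "set ps \<subseteq> carr V \<times> carr W \<Longrightarrow> (\<Sum>(v, w)\<leftarrow>ps. tens V W v w) = 0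
    \<Longrightarrow> (\<Sum>(v, w)\<leftarrow>ps. \<beta> v w) = 0"
proof (induction "length ps" arbitrary: ps)
  case 0 thus ?case by simp
next
  case (Suc n)
  then obtain v w qs where ps: "ps = (v, w) # qs" by (metis length_Suc_conv surj_pair)
  have v: "v \<in> carr V" and w: "w \<in> carr W" and qs: "set qs \<subseteq> carr V \<times> carr W"
    using Suc.prems ps by auto
  interpret W: vector_space "smul W" using W by (simp add: is_vspace_def)
  show ?case
  proof (cases "w \<in> W.span (snd ` set qs)")
    case False
    obtain \<psi> where \<psi>: "\<psi> \<in> dual W" "\<psi> w = 1" "\<forall>x\<in>snd ` set qs. \<psi> x = 0"
      using separating_functional[OF W False] by blast
    have van: "(\<Sum>(v, w)\<leftarrow>rs. tens V W v w) (\<phi>, \<psi>) = 0"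
      if "\<forall>x\<in>snd ` set rs. \<psi> x = 0" for \<phi> rs
      using that by (induction rs) (auto simp: tens_def)
    have "\<phi> v = 0" if \<phi>: "\<phi> \<in> dual V" for \<phi>
    proof -
      have "0 = (\<Sum>(v, w)\<leftarrow>ps. tens V W v w) (\<phi>, \<psi>)" using Suc.prems(2) by simp
      also have "\<dots> = \<phi> v"
        using van[OF \<psi>(3)] \<phi> \<psi>(1,2) by (simp add: ps tens_def)
      finally show ?thesis by simp
    qed
    moreover interpret V: vector_space "smul V" using V by (simp add: is_vspace_def)
    have "\<exists>\<phi>\<in>dual V. \<phi> v = 1" if "v \<noteq> 0"
      using separating_functional[OF V, of v "{}"] that by auto
    ultimately have v0: "v = 0" by force
    have t0: "tens V W 0 w = 0"
      using linear_map_0[OF V bilinear_mapD(2)[OF bilinear_map_tens[OF V W] w]] .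
    have b0: "\<beta> 0 w = 0" using linear_map_0[OF V bilinear_mapD(2)[OF \<beta> w]] .
    have "(\<Sum>(v, w)\<leftarrow>qs. \<beta> v w) = 0"
      using Suc.hyps qs Suc.prems(2) by (intro Suc.hyps(1)) (auto simp: ps v0 t0)
    thus ?thesis by (simp add: ps v0 b0)
  next
    case True
    have "\<exists>cs. length cs = length rs \<and> x = (\<Sum>(c, p)\<leftarrow>zip cs rs. smul W c (snd p))"
      if "x \<in> W.span (snd ` set rs)" for x and rs :: "('v \<times> 'w) list"
      using that
    proof (induction rs arbitrary: x)
      case Nil thus ?case by simp
    next
      case (Cons r rs)
      from Cons.prems obtain k where "x - smul W k (snd r) \<in> W.span (snd ` set rs)"
        by (auto simp: W.span_insert)
      from Cons.IH[OF this] obtain cs where "length cs = length rs"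
        "x - smul W k (snd r) = (\<Sum>(c, p)\<leftarrow>zip cs rs. smul W c (snd p))" by blast
      thus ?case by (intro exI[of _ "k # cs"]) (auto simp: algebra_simps)
    qed
    from this[OF True] obtain cs where cs: "length cs = length qs"
      "w = (\<Sum>(c, p)\<leftarrow>zip cs qs. smul W c (snd p))" by blast
    define qs' where "qs' = map (\<lambda>(c, p). (fst p + smul V c v, snd p)) (zip cs qs)"
    have qs': "set qs' \<subseteq> carr V \<times> carr W" "length qs' = length qs"
      using qs cs(1) v is_vspaceD[OF V]
      by (auto simp: qs'_def dest!: set_zip_rightD)
    have expand: "(\<Sum>(v, w)\<leftarrow>ps. \<gamma> v w) = (\<Sum>(v, w)\<leftarrow>qs'. \<gamma> v w)"
      if \<gamma>: "bilinear_map V W X \<gamma>" for \<gamma> and X :: "('k, 'x::ab_group_add, 'y) vspace_scheme"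
    proof -
      have zc: "snd p \<in> carr W \<and> fst p \<in> carr V" if "(c, p) \<in> set (zip cs qs)" for c p
        using that qs by (auto dest!: set_zip_rightD)
      have "\<gamma> v w = (\<Sum>(c, p)\<leftarrow>zip cs qs. \<gamma> v (smul W c (snd p)))"
        unfolding cs(2) using linear_map_sum_list[OF W bilinear_mapD(1)[OF \<gamma> v],
            of "zip cs qs" "\<lambda>(c, p). smul W c (snd p)"] zc is_vspaceD(3)[OF W]
        by (auto simp: case_prod_unfold)
      also have "\<dots> = (\<Sum>(c, p)\<leftarrow>zip cs qs. \<gamma> (smul V c v) (snd p))"
      proof (intro arg_cong[of _ _ sum_list] map_cong refl, clarify)
        fix c a b assume "(c, a, b) \<in> set (zip cs qs)"
        hence "b \<in> carr W" using zc by fastforce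
        thus "\<gamma> v (smul W c (snd (a, b))) = \<gamma> (smul V c v) (snd (a, b))"
          using linear_mapD(3)[OF bilinear_mapD(1)[OF \<gamma> v]]
            linear_mapD(3)[OF bilinear_mapD(2)[OF \<gamma>] v] by simp
      qed
      finally have 1: "\<gamma> v w = (\<Sum>(c, p)\<leftarrow>zip cs qs. \<gamma> (smul V c v) (snd p))" .
      have "(\<Sum>(v, w)\<leftarrow>qs. \<gamma> v w) = (\<Sum>(c, p)\<leftarrow>zip cs qs. \<gamma> (fst p) (snd p))"
        using cs(1) by (induction cs qs rule: list_induct2) auto
      hence "(\<Sum>(v, w)\<leftarrow>ps. \<gamma> v w)
          = (\<Sum>(c, p)\<leftarrow>zip cs qs. \<gamma> (fst p) (snd p) + \<gamma> (smul V c v) (snd p))"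
        using 1 by (simp add: ps sum_list_addf case_prod_unfold add.commute)
      also have "\<dots> = (\<Sum>(c, p)\<leftarrow>zip cs qs. \<gamma> (fst p + smul V c v) (snd p))"
      proof (intro arg_cong[of _ _ sum_list] map_cong refl, clarify)
        fix c a b assume "(c, a, b) \<in> set (zip cs qs)"
        hence "a \<in> carr V" "b \<in> carr W" using zc by fastforce+
        thus "\<gamma> (fst (a, b)) (snd (a, b)) + \<gamma> (smul V c v) (snd (a, b))
            = \<gamma> (fst (a, b) + smul V c v) (snd (a, b))"
          using linear_mapD(2)[OF bilinear_mapD(2)[OF \<gamma>]] is_vspaceD(3)[OF V v] by simp
      qed
      also have "\<dots> = (\<Sum>(v, w)\<leftarrow>qs'. \<gamma> v w)"
        by (simp add: qs'_def case_prod_unfold o_def)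
      finally show ?thesis .
    qed
    have "(\<Sum>(v, w)\<leftarrow>qs'. tens V W v w) = 0"
      using expand[OF bilinear_map_tens[OF V W]] Suc.prems(2) by simp
    hence "(\<Sum>(v, w)\<leftarrow>qs'. \<beta> v w) = 0"
      using qs' Suc.hyps ps by (intro Suc.hyps(1)) auto
    thus ?thesis using expand[OF \<beta>] by simp
  qed
qed

lemma tensor_lift_sum:
  fixes V :: "('k::field, 'v::ab_group_add, 'm) vspace_scheme"
    and W :: "('k, 'w::ab_group_add, 'n) vspace_scheme"
  assumes V: "is_vspace V" and W: "is_vspace W" and U: "is_vspace U"
    and \<beta>: "bilinear_map V W U \<beta>" and ps: "set ps \<subseteq> carr V \<times> carr W"
  shows "tensor_lift V W \<beta> (\<Sum>(v, w)\<leftarrow>ps. tens V W v w) = (\<Sum>(v, w)\<leftarrow>ps. \<beta> v w)"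
  unfolding tensor_lift_def
proof (rule the_equality)
  show "\<exists>qs. set qs \<subseteq> carr V \<times> carr W \<and>
      (\<Sum>(v, w)\<leftarrow>ps. tens V W v w) = (\<Sum>(v, w)\<leftarrow>qs. tens V W v w) \<and>
      (\<Sum>(v, w)\<leftarrow>ps. \<beta> v w) = (\<Sum>(v, w)\<leftarrow>qs. \<beta> v w)" using ps by blast
next
  fix x
  assume "\<exists>qs. set qs \<subseteq> carr V \<times> carr W \<and>
      (\<Sum>(v, w)\<leftarrow>ps. tens V W v w) = (\<Sum>(v, w)\<leftarrow>qs. tens V W v w) \<and>
      x = (\<Sum>(v, w)\<leftarrow>qs. \<beta> v w)"
  then obtain qs where qs: "set qs \<subseteq> carr V \<times> carr W"
    "(\<Sum>(v, w)\<leftarrow>ps. tens V W v w) = (\<Sum>(v, w)\<leftarrow>qs. tens V W v w)"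
    "x = (\<Sum>(v, w)\<leftarrow>qs. \<beta> v w)" by blast
  define rs where "rs = ps @ map (\<lambda>(v, w). (smul V (-1) v, w)) qs"
  have rs: "set rs \<subseteq> carr V \<times> carr W" using ps qs(1) is_vspaceD(3)[OF V] by (auto simp: rs_def)
  have neg: "(\<Sum>(v, w)\<leftarrow>map (\<lambda>(v, w). (smul V (-1) v, w)) qs. \<gamma> v w) = - (\<Sum>(v, w)\<leftarrow>qs. \<gamma> v w)"
    if "bilinear_map V W X \<gamma>" "is_vspace X" for X :: "('k, 'x::ab_group_add, 'y) vspace_scheme" and \<gamma>
  proof -
    interpret X: vector_space "smul X" using that(2) by (simp add: is_vspace_def)
    show ?thesis using qs(1)
    proof (induction qs)
      case (Cons q qs)
      then obtain v w where q: "q = (v, w)" "v \<in> carr V" "w \<in> carr W" by auto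
      have "\<gamma> (smul V (-1) v) w = - \<gamma> v w"
        using linear_mapD(3)[OF bilinear_mapD(2)[OF that(1) q(3)] q(2)] by simp
      thus ?case using Cons q by simp
    qed simp
  qed
  have "(\<Sum>(v, w)\<leftarrow>rs. tens V W v w) = 0"
    using neg[OF bilinear_map_tens[OF V W] is_vspace_tensor_space] qs(2) by (simp add: rs_def)
  hence "(\<Sum>(v, w)\<leftarrow>rs. \<beta> v w) = 0" using sum_tens_eq_0[OF V W U \<beta> rs] by blast
  thus "x = (\<Sum>(v, w)\<leftarrow>ps. \<beta> v w)" using neg[OF \<beta> U] qs(3) by (simp add: rs_def)
qed

lemma in_tensor_space_iff:
  fixes V :: "('k::field, 'v::ab_group_add, 'm) vspace_scheme"
    and W :: "('k, 'w::ab_group_add, 'n) vspace_scheme"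
  assumes V: "is_vspace V" and W: "is_vspace W"
  shows "t \<in> carr (tensor_space V W) \<longleftrightarrow>
    (\<exists>ps. set ps \<subseteq> carr V \<times> carr W \<and> t = (\<Sum>(v, w)\<leftarrow>ps. tens V W v w))"
proof
  interpret T: vector_space "pointwise_smul :: 'k \<Rightarrow> (('v \<Rightarrow> 'k) \<times> ('w \<Rightarrow> 'k) \<Rightarrow> 'k) \<Rightarrow> _"
    by (rule vector_space_pointwise)
  assume "t \<in> carr (tensor_space V W)"
  hence "t \<in> T.span {tens V W v w | v w. v \<in> carr V \<and> w \<in> carr W}"
    by (simp add: tensor_space_def)
  thus "\<exists>ps. set ps \<subseteq> carr V \<times> carr W \<and> t = (\<Sum>(v, w)\<leftarrow>ps. tens V W v w)"
  proof (induction rule: T.span_induct_alt)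
    case base show ?case by (intro exI[of _ "[]"]) auto
  next
    case (step c x y)
    then obtain v w ps where *: "x = tens V W v w" "v \<in> carr V" "w \<in> carr W"
      "set ps \<subseteq> carr V \<times> carr W" "y = (\<Sum>(v, w)\<leftarrow>ps. tens V W v w)" by blast
    have "tens V W (smul V c v) w = pointwise_smul c x"
      using linear_mapD(3)[OF bilinear_mapD(2)[OF bilinear_map_tens[OF V W] *(3)] *(2)]
      by (simp add: tensor_space_def *(1))
    thus ?case using * is_vspaceD(3)[OF V] by (intro exI[of _ "(smul V c v, w) # ps"]) auto
  qed
next
  assume "\<exists>ps. set ps \<subseteq> carr V \<times> carr W \<and> t = (\<Sum>(v, w)\<leftarrow>ps. tens V W v w)"
  then obtain ps where "set ps \<subseteq> carr V \<times> carr W" "t = (\<Sum>(v, w)\<leftarrow>ps. tens V W v w)" by blast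
  moreover have "linear_map (tensor_space V W) (tensor_space V W) id"
    by (simp add: linear_map_def)
  ultimately show "t \<in> carr (tensor_space V W)"
    using linear_map_sum_list[OF is_vspace_tensor_space, of V W _ id ps "\<lambda>p. tens V W (fst p) (snd p)"]
      linear_mapD(1)[OF bilinear_mapD(1)[OF bilinear_map_tens[OF V W]]]
    by (fastforce simp: case_prod_unfold)
qed

theorem tensor_universal:
  fixes V :: "('k::field, 'v::ab_group_add, 'm) vspace_scheme"
    and W :: "('k, 'w::ab_group_add, 'n) vspace_scheme"
  assumes V: "is_vspace V" and W: "is_vspace W" and U: "is_vspace U"
    and \<beta>: "bilinear_map V W U \<beta>"
  shows "linear_map (tensor_space V W) U (tensor_lift V W \<beta>)"
    and "\<And>v w. v \<in> carr V \<Longrightarrow> w \<in> carr W \<Longrightarrow> tensor_lift V W \<beta> (tens V W v w) = \<beta> v w"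
    and "\<And>g t. linear_map (tensor_space V W) U g \<Longrightarrow>
           (\<And>v w. v \<in> carr V \<Longrightarrow> w \<in> carr W \<Longrightarrow> g (tens V W v w) = \<beta> v w) \<Longrightarrow>
           t \<in> carr (tensor_space V W) \<Longrightarrow> g t = tensor_lift V W \<beta> t"
proof -
  note lift = tensor_lift_sum[OF V W U \<beta>]
  note in_T = in_tensor_space_iff[OF V W]
  show pure: "tensor_lift V W \<beta> (tens V W v w) = \<beta> v w" if "v \<in> carr V" "w \<in> carr W" for v w
    using lift[of "[(v, w)]"] that by simp
  show "linear_map (tensor_space V W) U (tensor_lift V W \<beta>)"
    unfolding linear_map_def
  proof (intro conjI ballI allI)
    fix s assume "s \<in> carr (tensor_space V W)"
    then obtain ps where ps: "set ps \<subseteq> carr V \<times> carr W" "s = (\<Sum>(v, w)\<leftarrow>ps. tens V W v w)"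
      unfolding in_T by blast
    have "(\<Sum>(v, w)\<leftarrow>ps. \<beta> v w) \<in> carr U" using ps(1)
    proof (induction ps)
      case (Cons p ps)
      thus ?case using is_vspaceD(4)[OF U] linear_mapD(1)[OF bilinear_mapD(1)[OF \<beta>]]
        by (auto simp: case_prod_beta)
    qed (simp add: is_vspaceD(2)[OF U])
    thus "tensor_lift V W \<beta> s \<in> carr U" using lift[OF ps(1)] ps(2) by simp
    { fix r
      define qs where "qs = map (\<lambda>(v, w). (smul V r v, w)) ps"
      have sc: "(\<Sum>(v, w)\<leftarrow>qs. \<gamma> v w) = smul X r (\<Sum>(v, w)\<leftarrow>ps. \<gamma> v w)"
        if "bilinear_map V W X \<gamma>" "is_vspace X"
        for X :: "('k, 'x::ab_group_add, 'y) vspace_scheme" and \<gamma>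
      proof -
        interpret X: vector_space "smul X" using that(2) by (simp add: is_vspace_def)
        show ?thesis using ps(1) unfolding qs_def
        proof (induction ps)
          case (Cons p ps)
          thus ?case using linear_mapD(3)[OF bilinear_mapD(2)[OF that(1)]]
            by (auto simp: case_prod_beta X.scale_right_distrib)
        qed simp
      qed
      have "set qs \<subseteq> carr V \<times> carr W" using ps(1) is_vspaceD(3)[OF V] by (auto simp: qs_def)
      thus "tensor_lift V W \<beta> (smul (tensor_space V W) r s) = smul U r (tensor_lift V W \<beta> s)"
        using sc[OF bilinear_map_tens[OF V W] is_vspace_tensor_space] sc[OF \<beta> U]
          lift[of qs] lift[OF ps(1)] ps(2) by simp
    }
    { fix t assume "t \<in> carr (tensor_space V W)"
      then obtain qs where qs: "set qs \<subseteq> carr V \<times> carr W" "t = (\<Sum>(v, w)\<leftarrow>qs. tens V W v w)"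
        unfolding in_T by blast
      show "tensor_lift V W \<beta> (s + t) = tensor_lift V W \<beta> s + tensor_lift V W \<beta> t"
        using lift[of "ps @ qs"] lift[OF ps(1)] lift[OF qs(1)] ps qs by simp
    }
  qed
  show "g t = tensor_lift V W \<beta> t"
    if g: "linear_map (tensor_space V W) U g"
      "\<And>v w. v \<in> carr V \<Longrightarrow> w \<in> carr W \<Longrightarrow> g (tens V W v w) = \<beta> v w"
      and t: "t \<in> carr (tensor_space V W)" for g t
  proof -
    obtain ps where ps: "set ps \<subseteq> carr V \<times> carr W" "t = (\<Sum>(v, w)\<leftarrow>ps. tens V W v w)"
      using t unfolding in_T by blast
    have "tens V W (fst p) (snd p) \<in> carr (tensor_space V W)" if "p \<in> set ps" for p
      using that ps(1) linear_mapD(1)[OF bilinear_mapD(1)[OF bilinear_map_tens[OF V W]]] by auto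
    hence "g t = (\<Sum>p\<leftarrow>ps. g (tens V W (fst p) (snd p)))"
      using linear_map_sum_list[OF is_vspace_tensor_space g(1), of ps "\<lambda>p. tens V W (fst p) (snd p)"]
      by (simp add: ps(2) case_prod_unfold)
    also have "\<dots> = (\<Sum>(v, w)\<leftarrow>ps. \<beta> v w)"
      using ps(1) g(2) by (intro arg_cong[of _ _ sum_list] map_cong) (auto simp: case_prod_beta)
    finally show ?thesis using lift[OF ps(1)] ps(2) by simp
  qed
qed

definition tensor_map ::
  "('k::field, 'v::ab_group_add, 'm) vspace_scheme \<Rightarrow> ('k, 'w::ab_group_add, 'n) vspace_scheme
    \<Rightarrow> ('k, 'v'::ab_group_add, 'm1) vspace_scheme \<Rightarrow> ('k, 'w'::ab_group_add, 'n1) vspace_scheme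
    \<Rightarrow> ('v \<Rightarrow> 'v') \<Rightarrow> ('w \<Rightarrow> 'w') \<Rightarrow> ('k, 'v, 'w) tensor \<Rightarrow> ('k, 'v', 'w') tensor" where
  "tensor_map V W V' W' f g = tensor_lift V W (\<lambda>v w. tens V' W' (f v) (g w))"

definition tensor_assoc ::
  "('k::field, 'u::ab_group_add, 'l) vspace_scheme \<Rightarrow> ('k, 'v::ab_group_add, 'm) vspace_scheme
    \<Rightarrow> ('k, 'w::ab_group_add, 'n) vspace_scheme
    \<Rightarrow> ('k, ('k, 'u, 'v) tensor, 'w) tensor \<Rightarrow> ('k, 'u, ('k, 'v, 'w) tensor) tensor" where
  "tensor_assoc U V W =
     tensor_lift (tensor_space U V) W
       (\<lambda>t w. tensor_lift U V (\<lambda>u v. tens U (tensor_space V W) u (tens V W v w)) t)"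


section \<open>Coalgebras and bialgebras\<close>

record ('k, 'c) coalg = "('k, 'c) vspace" +
  comult :: "'c \<Rightarrow> ('k, 'c, 'c) tensor"
  counit :: "'c \<Rightarrow> 'k"

definition coalgebra :: "('k::field, 'c::ab_group_add) coalg \<Rightarrow> bool" where
  "coalgebra C \<longleftrightarrow>
     is_vspace C \<and>
     linear_map C (tensor_space C C) (comult C) \<and>
     linear_map C base_field (counit C) \<and>
     (\<forall>c\<in>carr C.
        tensor_assoc C C C (tensor_map C C (tensor_space C C) C (comult C) id (comult C c)) =
        tensor_map C C C (tensor_space C C) id (comult C) (comult C c)) \<and>
     (\<forall>c\<in>carr C. tensor_lift C C (\<lambda>x y. smul C (counit C x) y) (comult C c) = c) \<and>
     (\<forall>c\<in>carr C. tensor_lift C C (\<lambda>x y. smul C (counit C y) x) (comult C c) = c)"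

definition coalgebra_map ::
  "('k::field, 'c::ab_group_add) coalg \<Rightarrow> ('k, 'd::ab_group_add) coalg \<Rightarrow> ('c \<Rightarrow> 'd) \<Rightarrow> bool" where
  "coalgebra_map C D F \<longleftrightarrow>
     linear_map C D F \<and>
     (\<forall>c\<in>carr C. comult D (F c) = tensor_map C C D D F F (comult C c)) \<and>
     (\<forall>c\<in>carr C. counit D (F c) = counit C c)"

definition tensor_coalgebra ::
  "('k::field, 'b::ab_group_add) coalg \<Rightarrow> ('k, 'c::ab_group_add) coalg
    \<Rightarrow> ('k, ('k, 'b, 'c) tensor) coalg" where
  "tensor_coalgebra B C =
     \<lparr>carr = carr (tensor_space B C),
      smul = smul (tensor_space B C),
      comult = tensor_lift B C (\<lambda>b c.
        tensor_lift B B (\<lambda>b\<^sub>1 b\<^sub>2.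
          tensor_lift C C (\<lambda>c\<^sub>1 c\<^sub>2.
            tens (tensor_space B C) (tensor_space B C) (tens B C b\<^sub>1 c\<^sub>1) (tens B C b\<^sub>2 c\<^sub>2))
          (comult C c)) (comult B b)),
      counit = tensor_lift B C (\<lambda>b c. counit B b * counit C c)\<rparr>"

definition tensor_mult ::
  "('k::field, 'a::ring_1, 'm) vspace_scheme
    \<Rightarrow> ('k, 'a, 'a) tensor \<Rightarrow> ('k, 'a, 'a) tensor \<Rightarrow> ('k, 'a, 'a) tensor" where
  "tensor_mult A s t =
     tensor_lift A A (\<lambda>x y. tensor_lift A A (\<lambda>x' y'. tens A A (x * x') (y * y')) t) s"

text \<open>
  The underlying ring of a bialgebra is a whole type of class \<open>ring_1\<close>. The axiom
  \<open>0 \<noteq> 1\<close> of this class excludes nothing, since \<open>\<epsilon> 1 = 1\<close> in every bialgebra over a field.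
\<close>

definition bialgebra :: "('k::field, 'a::ring_1) coalg \<Rightarrow> bool" where
  "bialgebra A \<longleftrightarrow>
     coalgebra A \<and> carr A = UNIV \<and>
     (\<forall>r x y. smul A r x * y = smul A r (x * y) \<and> x * smul A r y = smul A r (x * y)) \<and>
     (\<forall>x y. comult A (x * y) = tensor_mult A (comult A x) (comult A y)) \<and>
     comult A 1 = tens A A 1 1 \<and>
     (\<forall>x y. counit A (x * y) = counit A x * counit A y) \<and>
     counit A 1 = 1"


section \<open>Measurings and partial coverings\<close>

definition measuring ::
  "('k::field, 'b::ring_1) coalg \<Rightarrow> ('k, 'c::ab_group_add) coalg \<Rightarrow> ('k, 'a::ring_1) coalg
    \<Rightarrow> (('k, 'b, 'c) tensor \<Rightarrow> 'a) \<Rightarrow> bool" where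
  "measuring B C A f \<longleftrightarrow>
     linear_map (tensor_space B C) A f \<and>
     (\<forall>b\<in>carr B. \<forall>b'\<in>carr B. \<forall>c\<in>carr C.
        f (tens B C (b * b') c) =
        tensor_lift C C (\<lambda>c\<^sub>1 c\<^sub>2. f (tens B C b c\<^sub>1) * f (tens B C b' c\<^sub>2)) (comult C c)) \<and>
     (\<forall>c\<in>carr C. f (tens B C 1 c) = smul A (counit C c) 1)"

definition partial_covering ::
  "('k::field, 'b::ring_1) coalg \<Rightarrow> ('k, 'c::ab_group_add) coalg \<Rightarrow> ('k, 'a::ring_1) coalg
    \<Rightarrow> (('k, 'b, 'c) tensor \<Rightarrow> 'a) \<Rightarrow> bool" where
  "partial_covering B C A f \<longleftrightarrow>
     measuring B C A f \<and> coalgebra_map (tensor_coalgebra B C) A f"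


section \<open>The universal covering coalgebra\<close>

text \<open>
  In an existential statement in HOL the witness could depend on the type carrying the test
  coalgebra \<open>C\<close>. To rule this out, the universal object is a constant whose type mentions
  only the types of \<open>B\<close>, \<open>A\<close> and the field. It lives in the space of \<open>'k\<close>-valued functions on words
  over \<open>'b \<times> ('a \<Rightarrow> 'k)\<close>, which is large enough: for a partial covering \<open>f\<close> on \<open>C\<close>, one sends \<open>c\<close> to
  \<open>[(b\<^sub>1, \<phi>\<^sub>1), \<dots>, (b\<^sub>n, \<phi>\<^sub>n)] \<mapsto> \<Sum>\<^sub>(\<^sub>c\<^sub>) \<phi>\<^sub>1 (f (b\<^sub>1 \<otimes> c\<^sub>1)) * \<dots> * \<phi>\<^sub>n (f (b\<^sub>n \<otimes> c\<^sub>n))\<close> for linear \<open>\<phi>\<^sub>i\<close>.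
  The choice below only constrains test coalgebras on this same type, which already
  determines the object up to isomorphism. That it exists, and that it is universal
  for test coalgebras on arbitrary types, has to be proved.

  Linear maps are HOL functions whose values matter only on the carrier. Extensionality
  fixes the values elsewhere, so that uniqueness can be expressed by \<open>\<exists>!\<close>.
\<close>

type_synonym ('k, 'b, 'a) words = "('b \<times> ('a \<Rightarrow> 'k)) list \<Rightarrow> 'k"

definition universal_pair ::
  "('k::field, 'b::ring_1) coalg \<Rightarrow> ('k, 'a::ring_1) coalg
    \<Rightarrow> ('k, ('k, 'b, 'a) words) coalg \<times> (('k, 'b, ('k, 'b, 'a) words) tensor \<Rightarrow> 'a)" where
  "universal_pair B A =
     (SOME (U, \<Omega>). coalgebra U \<and> partial_covering B U A \<Omega> \<and>
        (\<forall>(C :: ('k, ('k, 'b, 'a) words) coalg) f.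
           coalgebra C \<and> partial_covering B C A f \<longrightarrow>
           (\<exists>!F. F \<in> extensional (carr C) \<and> coalgebra_map C U F \<and>
                 (\<forall>t\<in>carr (tensor_space B C). f t = \<Omega> (tensor_map B C B U id F t)))))"

definition universal_covering_coalgebra ::
  "('k::field, 'b::ring_1) coalg \<Rightarrow> ('k, 'a::ring_1) coalg \<Rightarrow> ('k, ('k, 'b, 'a) words) coalg" where
  "universal_covering_coalgebra B A = fst (universal_pair B A)"

definition universal_partial_covering ::
  "('k::field, 'b::ring_1) coalg \<Rightarrow> ('k, 'a::ring_1) coalg
    \<Rightarrow> ('k, 'b, ('k, 'b, 'a) words) tensor \<Rightarrow> 'a" where
  "universal_partial_covering B A = snd (universal_pair B A)"

end

theory Submission
  imports Defs
begin

text \<open>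
  A partial covering \<open>f\<close> on \<open>B \<otimes> C\<close> assigns to each letter \<open>(b, \<phi>)\<close>, with \<open>\<phi>\<close> a linear functional on \<open>A\<close>,
  the functional \<open>c \<mapsto> \<phi> (f (b \<otimes> c))\<close> on \<open>C\<close>. The dual of \<open>C\<close> is an algebra under
  convolution, so words in these letters act as products, and every \<open>c\<close> becomes a function on words.
  The comultiplication of \<open>C\<close> becomes the splitting of a function along concatenation,
  \<open>h (u @ v) = \<Sum> h\<^sub>1 u * h\<^sub>2 v\<close>, the counit becomes evaluation at the empty word, and \<open>f (b \<otimes> c)\<close> is
  recovered from the values on one-letter words. Hence all covering conditions can be stated
  for functions on words, without mentioning \<open>C\<close> or \<open>f\<close>.

  The universal object is the greatest set of functions on words whose elements satisfy these
  conditions and have splittings \<open>\<Sum> h\<^sub>1 \<otimes> h\<^sub>2\<close> with components in the set again (\<open>split_closed\<close>,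
  \<open>universal_carrier\<close>). Being the greatest, it is a subspace, and it contains the image of
  every partial covering (\<open>to_words_in_universal_carrier\<close>). Evaluations at words separate its
  points and, by \<open>separating_pairing\<close>, evaluations at tuples of words separate the points of its tensor powers.
  Therefore the splitting of a function is a well-defined tensor (\<open>representative_comult_unique\<close>), and
  coassociativity reduces to associativity of concatenation (\<open>coalgebra_representative\<close>).

  A coalgebra map into this coalgebra that is compatible with a given covering is prescribed on the empty word
  by the counit and on letters by the covering, and on longer words by compatibility with the
  comultiplication (\<open>to_words_unique\<close>); this is the uniqueness of the factorization.

  The constants of the theorem denote a chosen pair that is universal for test coalgebras whose
  elements are functions on words. The pair constructed here is universal for all test coalgebras, in
  particular for those, so the two pairs are isomorphic, and universality for arbitrary test coalgebras
  is transported along the isomorphism.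
\<close>


section \<open>Linear and bilinear maps\<close>

lemma linear_map_comp:
  assumes "linear_map V W f" "linear_map W U g"
  shows "linear_map V U (\<lambda>x. g (f x))"
  using assms by (simp add: linear_map_def)

lemma linear_map_cong:
  assumes "is_vspace V" "\<And>x. x \<in> carr V \<Longrightarrow> f x = g x"
  shows "linear_map V W f \<longleftrightarrow> linear_map V W g"
  using assms is_vspaceD(3,4)[OF assms(1)] by (simp add: linear_map_def)

lemma linear_map_ident: "linear_map V V (\<lambda>x. x)"
  by (simp add: linear_map_def)

lemma linear_map_plus:
  assumes "is_vspace W" "linear_map V W f" "linear_map V W g"
  shows "linear_map V W (\<lambda>x. f x + g x)"
proof -
  interpret W: vector_space "smul W" using assms(1) by (rule is_vspaceD)
  show ?thesis
    using assms by (auto simp: linear_map_def W.scale_right_distrib is_vspaceD(4))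
qed

lemma linear_map_list_sum:
  assumes "is_vspace W" "\<And>p. p \<in> set ps \<Longrightarrow> linear_map V W (\<lambda>x. f p x)"
  shows "linear_map V W (\<lambda>x. \<Sum>p\<leftarrow>ps. f p x)"
  using assms(2)
proof (induction ps)
  case Nil
  interpret W: vector_space "smul W" using assms(1) by (rule is_vspaceD)
  show ?case using is_vspaceD(2)[OF assms(1)] by (simp add: linear_map_def)
next
  case (Cons p ps)
  then show ?case by (simp add: linear_map_plus[OF assms(1)])
qed

lemma smul_sum_list:
  assumes "vector_space s"
  shows "s r (\<Sum>x\<leftarrow>xs. f x) = (\<Sum>x\<leftarrow>xs. s r (f x))"
proof -
  interpret vector_space s by (rule assms)
  show ?thesis by (induction xs) (simp_all add: scale_right_distrib)
qed

lemma is_vspace_sum_list: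
  assumes "is_vspace V" "\<And>x. x \<in> set xs \<Longrightarrow> f x \<in> carr V"
  shows "(\<Sum>x\<leftarrow>xs. f x) \<in> carr V"
  using linear_map_sum_list[OF assms(1) linear_map_ident] assms(2) by blast

lemma bilinear_mapI:
  assumes "\<And>v. v \<in> carr V \<Longrightarrow> linear_map W U (\<lambda>w. \<beta> v w)"
    and "\<And>w. w \<in> carr W \<Longrightarrow> linear_map V U (\<lambda>v. \<beta> v w)"
  shows "bilinear_map V W U \<beta>"
  using assms by (simp add: bilinear_map_def)

lemma bilinear_map_comp:
  assumes "bilinear_map V W U \<beta>" "linear_map V' V f" "linear_map W' W g"
  shows "bilinear_map V' W' U (\<lambda>v w. \<beta> (f v) (g w))"
proof (rule bilinear_mapI)
  fix v assume "v \<in> carr V'"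
  hence "linear_map W U (\<beta> (f v))"
    using assms by (auto intro: bilinear_mapD linear_mapD)
  from linear_map_comp[OF assms(3) this] show "linear_map W' U (\<lambda>w. \<beta> (f v) (g w))" .
next
  fix w assume "w \<in> carr W'"
  hence "linear_map V U (\<lambda>v. \<beta> v (g w))"
    using assms by (auto intro: bilinear_mapD linear_mapD)
  from linear_map_comp[OF assms(2) this] show "linear_map V' U (\<lambda>v. \<beta> (f v) (g w))" .
qed

lemma linear_bilinear_map_comp:
  assumes "bilinear_map V W U \<beta>" "linear_map U X g"
  shows "bilinear_map V W X (\<lambda>v w. g (\<beta> v w))"
  by (intro bilinear_mapI linear_map_comp[OF _ assms(2)] bilinear_mapD[OF assms(1)])

lemma bilinear_map_list_sum:
  assumes "is_vspace U" "\<And>p. p \<in> set ps \<Longrightarrow> bilinear_map V W U (\<beta> p)"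
  shows "bilinear_map V W U (\<lambda>v w. \<Sum>p\<leftarrow>ps. \<beta> p v w)"
  using assms by (intro bilinear_mapI linear_map_list_sum) (auto dest: bilinear_mapD)

lemma bilinear_map_cong:
  assumes "is_vspace V" "is_vspace W"
    "\<And>v w. v \<in> carr V \<Longrightarrow> w \<in> carr W \<Longrightarrow> \<beta> v w = \<gamma> v w"
  shows "bilinear_map V W U \<beta> \<longleftrightarrow> bilinear_map V W U \<gamma>"
  unfolding bilinear_map_def using assms(3)
  by (intro arg_cong2[of _ _ _ _ "(\<and>)"] ball_cong refl linear_map_cong assms(1,2)) auto

lemma bilinear_map_smul:
  assumes "is_vspace V"
  shows "bilinear_map base_field V V (smul V)"
proof -
  interpret V: vector_space "smul V" using assms by (rule is_vspaceD)
  show ?thesis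
    using is_vspaceD(3)[OF assms]
    by (auto intro!: bilinear_mapI simp: linear_map_def base_field_def
        V.scale_right_distrib V.scale_left_distrib V.scale_left_commute)
qed

lemma bilinear_map_functionals:
  assumes "\<phi> \<in> dual V" "\<psi> \<in> dual W"
  shows "bilinear_map V W base_field (\<lambda>v w. \<phi> v * \<psi> w)"
  using assms
  by (auto intro!: bilinear_mapI simp: dual_def linear_map_def base_field_def algebra_simps)

lemma dual_comp:
  assumes "linear_map V W f" "\<phi> \<in> dual W"
  shows "(\<lambda>x. \<phi> (f x)) \<in> dual V"
  using assms linear_map_comp by (auto simp: dual_def)

lemma dual_list_sum:
  assumes "is_vspace V" "\<phi> \<in> dual V" "\<And>x. x \<in> set xs \<Longrightarrow> g x \<in> carr V"
  shows "\<phi> (\<Sum>x\<leftarrow>xs. g x) = (\<Sum>x\<leftarrow>xs. \<phi> (g x))"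
  using linear_map_sum_list[OF assms(1), of base_field \<phi> xs g] assms(2,3) by (simp add: dual_def)

lemma dual_add:
  assumes "\<phi> \<in> dual V" "v \<in> carr V" "w \<in> carr V"
  shows "\<phi> (v + w) = \<phi> v + \<phi> w"
  using assms by (simp add: dual_def linear_map_def)

lemma dual_scale:
  assumes "\<phi> \<in> dual V" "v \<in> carr V"
  shows "\<phi> (smul V r v) = r * \<phi> v"
  using assms by (simp add: dual_def linear_map_def base_field_def)

lemma dual_separates:
  assumes "is_vspace V" "v \<in> carr V" "w \<in> carr V" "\<And>\<phi>. \<phi> \<in> dual V \<Longrightarrow> \<phi> v = \<phi> w"
  shows "v = w"
proof (rule ccontr)
  interpret V: vector_space "smul V" using assms(1) by (rule is_vspaceD)
  assume "v \<noteq> w"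
  hence "v - w \<notin> V.span {}" by simp
  then obtain \<phi> where \<phi>: "\<phi> \<in> dual V" "\<phi> (v - w) = 1"
    using separating_functional[OF assms(1)] by blast
  have "smul V (-1) w \<in> carr V" using is_vspaceD(3)[OF assms(1,3)] .
  hence "\<phi> (v + smul V (-1) w) = \<phi> v + (-1) * \<phi> w"
    by (simp only: dual_add[OF \<phi>(1) assms(2)] dual_scale[OF \<phi>(1) assms(3)])
  hence "\<phi> (v - w) = \<phi> v - \<phi> w" by simp
  with \<phi>(2) assms(4)[OF \<phi>(1)] show False by simp
qed


section \<open>Computing with tensors\<close>

text \<open>
  Sweedler sums become sums over lists: \<open>ps\<close> is a list of pairs \<open>(c\<^sub>1, c\<^sub>2)\<close> when
  \<open>t\<close> is \<open>\<Delta> c\<close>. The list is not determined by \<open>t\<close>; what makes it usable is that a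
  lift of a bilinear map can be computed from any such list.
\<close>

definition represents ::
  "('k::field, 'v::ab_group_add, 'm) vspace_scheme \<Rightarrow> ('k, 'w::ab_group_add, 'n) vspace_scheme
    \<Rightarrow> ('k, 'v, 'w) tensor \<Rightarrow> ('v \<times> 'w) list \<Rightarrow> bool" where
  "represents V W t ps \<longleftrightarrow>
     set ps \<subseteq> carr V \<times> carr W \<and> t = (\<Sum>(v, w)\<leftarrow>ps. tens V W v w)"

lemma represents_exists:
  assumes "is_vspace V" "is_vspace W" "t \<in> carr (tensor_space V W)"
  obtains ps where "represents V W t ps"
  using assms in_tensor_space_iff[OF assms(1,2)] by (auto simp: represents_def)

lemma represents_in_tensor_space:
  assumes "is_vspace V" "is_vspace W" "represents V W t ps"
  shows "t \<in> carr (tensor_space V W)"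
  using assms in_tensor_space_iff[OF assms(1,2)] by (auto simp: represents_def)

lemma representsD:
  assumes "represents V W t ps" "(v, w) \<in> set ps"
  shows "v \<in> carr V" "w \<in> carr W"
  using assms by (auto simp: represents_def)

lemma tens_in_tensor_space:
  assumes "is_vspace V" "is_vspace W" "v \<in> carr V" "w \<in> carr W"
  shows "tens V W v w \<in> carr (tensor_space V W)"
  using linear_mapD(1)[OF bilinear_mapD(1)[OF bilinear_map_tens]] assms by blast

lemma tensor_lift_represents:
  assumes "is_vspace V" "is_vspace W" "is_vspace U" "bilinear_map V W U \<beta>" "represents V W t ps"
  shows "tensor_lift V W \<beta> t = (\<Sum>(v, w)\<leftarrow>ps. \<beta> v w)"
  using tensor_lift_sum[OF assms(1-4)] assms(5) by (simp add: represents_def)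

lemma tensor_lift_cong:
  assumes "\<And>v w. v \<in> carr V \<Longrightarrow> w \<in> carr W \<Longrightarrow> \<beta> v w = \<gamma> v w"
  shows "tensor_lift V W \<beta> t = tensor_lift V W \<gamma> t"
proof -
  have "(\<Sum>(v, w)\<leftarrow>ps. \<beta> v w) = (\<Sum>(v, w)\<leftarrow>ps. \<gamma> v w)" if "set ps \<subseteq> carr V \<times> carr W" for ps
    using that assms by (intro arg_cong[of _ _ sum_list] map_cong) auto
  hence "(set ps \<subseteq> carr V \<times> carr W \<and> t = (\<Sum>(v, w)\<leftarrow>ps. tens V W v w) \<and>
            x = (\<Sum>(v, w)\<leftarrow>ps. \<beta> v w)) \<longleftrightarrow>
         (set ps \<subseteq> carr V \<times> carr W \<and> t = (\<Sum>(v, w)\<leftarrow>ps. tens V W v w) \<and>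
            x = (\<Sum>(v, w)\<leftarrow>ps. \<gamma> v w))" for ps x
    by auto
  thus ?thesis by (simp only: tensor_lift_def)
qed

lemma linear_map_tensor_lift:
  assumes "is_vspace V" "is_vspace W" "is_vspace U" "is_vspace X" "bilinear_map V W U \<beta>"
    "linear_map U X g" "t \<in> carr (tensor_space V W)"
  shows "g (tensor_lift V W \<beta> t) = tensor_lift V W (\<lambda>v w. g (\<beta> v w)) t"
proof -
  obtain ps where ps: "represents V W t ps" using represents_exists assms by blast
  have in_U: "\<beta> (fst p) (snd p) \<in> carr U" if "p \<in> set ps" for p
    using that linear_mapD(1)[OF bilinear_mapD(1)[OF assms(5)]] representsD[OF ps]
    by (metis prod.collapse)
  show ?thesis
    using linear_map_sum_list[OF assms(3,6), of ps "\<lambda>p. \<beta> (fst p) (snd p)"] in_U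
      tensor_lift_represents[OF assms(1-3,5) ps]
      tensor_lift_represents[OF assms(1,2,4) linear_bilinear_map_comp[OF assms(5,6)] ps]
    by (simp add: case_prod_unfold)
qed

lemma linear_maps_tensor_eqI:
  assumes "is_vspace V" "is_vspace W" "is_vspace U"
    "linear_map (tensor_space V W) U f" "linear_map (tensor_space V W) U g"
    "\<And>v w. v \<in> carr V \<Longrightarrow> w \<in> carr W \<Longrightarrow> f (tens V W v w) = g (tens V W v w)"
    "t \<in> carr (tensor_space V W)"
  shows "f t = g t"
proof -
  have \<beta>: "bilinear_map V W U (\<lambda>v w. g (tens V W v w))"
    using linear_bilinear_map_comp[OF bilinear_map_tens assms(5)] assms(1,2) by blast
  have "f t = tensor_lift V W (\<lambda>v w. g (tens V W v w)) t"
    by (rule tensor_universal(3)[OF assms(1-3) \<beta> assms(4,6,7)])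
  moreover have "g t = tensor_lift V W (\<lambda>v w. g (tens V W v w)) t"
    by (rule tensor_universal(3)[OF assms(1-3) \<beta> assms(5) refl assms(7)])
  ultimately show ?thesis by simp
qed

text \<open>
  On a list representing \<open>t\<close> the lift is one and the same finite sum for all parameters, so it
  inherits linearity in a parameter. This is what makes iterated lifts, such as the
  associator and the comultiplication of \<open>B \<otimes> C\<close>, bilinear.
\<close>

lemma linear_map_tensor_lift_param:
  assumes "is_vspace V" "is_vspace W" "is_vspace U"
    and "\<And>z. z \<in> carr Z \<Longrightarrow> bilinear_map V W U (\<gamma> z)"
    and "\<And>v w. v \<in> carr V \<Longrightarrow> w \<in> carr W \<Longrightarrow> linear_map Z U (\<lambda>z. \<gamma> z v w)"
    and "is_vspace Z" "t \<in> carr (tensor_space V W)"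
  shows "linear_map Z U (\<lambda>z. tensor_lift V W (\<gamma> z) t)"
proof -
  obtain ps where ps: "represents V W t ps" using represents_exists assms by blast
  have "linear_map Z U (\<lambda>z. \<Sum>p\<leftarrow>ps. \<gamma> z (fst p) (snd p))"
    using representsD[OF ps] by (intro linear_map_list_sum assms(3) assms(5)) auto
  moreover have "tensor_lift V W (\<gamma> z) t = (\<Sum>p\<leftarrow>ps. \<gamma> z (fst p) (snd p))" if "z \<in> carr Z" for z
    using tensor_lift_represents[OF assms(1-3) assms(4)[OF that] ps] by (simp add: case_prod_unfold)
  ultimately show ?thesis
    by (subst linear_map_cong[OF assms(6)])
qed

lemma bilinear_map_tensor_lift:
  assumes "is_vspace V" "is_vspace W" "is_vspace U" "is_vspace Z"
    and "\<And>z. z \<in> carr Z \<Longrightarrow> bilinear_map V W U (\<gamma> z)"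
    and "\<And>v w. v \<in> carr V \<Longrightarrow> w \<in> carr W \<Longrightarrow> linear_map Z U (\<lambda>z. \<gamma> z v w)"
  shows "bilinear_map (tensor_space V W) Z U (\<lambda>t z. tensor_lift V W (\<gamma> z) t)"
  using linear_map_tensor_lift_param[OF assms(1-3,5,6,4)] tensor_universal(1)[OF assms(1-3,5)]
  by (intro bilinear_mapI) blast+

lemma tensor_lift_list_sum:
  assumes "is_vspace V" "is_vspace W" "is_vspace U"
    "\<And>p. p \<in> set ps \<Longrightarrow> bilinear_map V W U (\<beta> p)" "t \<in> carr (tensor_space V W)"
  shows "tensor_lift V W (\<lambda>v w. \<Sum>p\<leftarrow>ps. \<beta> p v w) t = (\<Sum>p\<leftarrow>ps. tensor_lift V W (\<beta> p) t)"
proof (rule linear_maps_tensor_eqI[OF assms(1-3) _ _ _ assms(5)])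
  have \<beta>: "bilinear_map V W U (\<lambda>v w. \<Sum>p\<leftarrow>ps. \<beta> p v w)"
    by (rule bilinear_map_list_sum[OF assms(3,4)])
  show "linear_map (tensor_space V W) U (tensor_lift V W (\<lambda>v w. \<Sum>p\<leftarrow>ps. \<beta> p v w))"
    by (rule tensor_universal(1)[OF assms(1-3) \<beta>])
  show "linear_map (tensor_space V W) U (\<lambda>t. \<Sum>p\<leftarrow>ps. tensor_lift V W (\<beta> p) t)"
    by (intro linear_map_list_sum tensor_universal(1)[OF assms(1-3)] assms)
  fix v w assume "v \<in> carr V" "w \<in> carr W"
  thus "tensor_lift V W (\<lambda>v w. \<Sum>p\<leftarrow>ps. \<beta> p v w) (tens V W v w)
      = (\<Sum>p\<leftarrow>ps. tensor_lift V W (\<beta> p) (tens V W v w))"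
    using tensor_universal(2)[OF assms(1-3) \<beta>] tensor_universal(2)[OF assms(1-3) assms(4)]
    by (simp cong: map_cong)
qed

text \<open>
  The functional \<open>\<phi> \<otimes> \<psi>\<close>. Equations between tensors are proved by testing them against such
  functionals, which turns them into equations between scalars.
\<close>

definition pairing ::
  "('k::field, 'v::ab_group_add, 'm) vspace_scheme \<Rightarrow> ('k, 'w::ab_group_add, 'n) vspace_scheme
    \<Rightarrow> ('v \<Rightarrow> 'k) \<Rightarrow> ('w \<Rightarrow> 'k) \<Rightarrow> ('k, 'v, 'w) tensor \<Rightarrow> 'k" where
  "pairing V W \<phi> \<psi> = tensor_lift V W (\<lambda>v w. \<phi> v * \<psi> w)"

lemma pairing_dual:
  assumes "is_vspace V" "is_vspace W" "\<phi> \<in> dual V" "\<psi> \<in> dual W"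
  shows "pairing V W \<phi> \<psi> \<in> dual (tensor_space V W)"
  using tensor_universal(1)[OF assms(1,2) is_vspace_base_field bilinear_map_functionals[OF assms(3,4)]]
  by (simp add: pairing_def dual_def)

lemma pairing_tens:
  assumes "is_vspace V" "is_vspace W" "\<phi> \<in> dual V" "\<psi> \<in> dual W" "v \<in> carr V" "w \<in> carr W"
  shows "pairing V W \<phi> \<psi> (tens V W v w) = \<phi> v * \<psi> w"
  using tensor_universal(2)[OF assms(1,2) is_vspace_base_field bilinear_map_functionals[OF assms(3,4)]]
    assms(5,6) by (simp add: pairing_def)

lemma pairing_represents:
  assumes "is_vspace V" "is_vspace W" "\<phi> \<in> dual V" "\<psi> \<in> dual W" "represents V W t ps"
  shows "pairing V W \<phi> \<psi> t = (\<Sum>(v, w)\<leftarrow>ps. \<phi> v * \<psi> w)"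
  using tensor_lift_represents[OF assms(1,2) is_vspace_base_field bilinear_map_functionals[OF assms(3,4)]]
    assms(5) by (simp add: pairing_def)

text \<open>
  The dual space always separates points, but for coalgebras of functions the evaluations
  form a much more convenient separating family; the lemma below carries it over
  to tensor products.
\<close>

definition separating ::
  "('k::field, 'v::ab_group_add, 'm) vspace_scheme \<Rightarrow> ('v \<Rightarrow> 'k) set \<Rightarrow> bool" where
  "separating V L \<longleftrightarrow> L \<subseteq> dual V \<and>
     (\<forall>v\<in>carr V. \<forall>w\<in>carr V. (\<forall>\<phi>\<in>L. \<phi> v = \<phi> w) \<longrightarrow> v = w)"

lemma separatingD:
  assumes "separating V L" "v \<in> carr V" "w \<in> carr V" "\<And>\<phi>. \<phi> \<in> L \<Longrightarrow> \<phi> v = \<phi> w"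
  shows "v = w"
  using assms by (auto simp: separating_def)

lemma sum_list_fun_apply: "(\<Sum>p\<leftarrow>ps. f p) x = (\<Sum>p\<leftarrow>ps. f p x)"
  by (induction ps) auto

text \<open>
  Contracting one factor at a time: fixing a functional of one family on the first factor leaves
  a vector of the second one, which the other family determines.
\<close>

lemma separating_pairing:
  fixes V :: "('k::field, 'v::ab_group_add, 'm) vspace_scheme"
    and W :: "('k, 'w::ab_group_add, 'n) vspace_scheme"
  assumes V: "is_vspace V" and W: "is_vspace W" and L: "separating V L" and M: "separating W M"
  shows "separating (tensor_space V W) {pairing V W \<phi> \<psi> | \<phi> \<psi>. \<phi> \<in> L \<and> \<psi> \<in> M}"
  unfolding separating_def
proof (intro conjI ballI impI)
  have LM: "L \<subseteq> dual V" "M \<subseteq> dual W" using L M by (auto simp: separating_def)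
  show "{pairing V W \<phi> \<psi> | \<phi> \<psi>. \<phi> \<in> L \<and> \<psi> \<in> M} \<subseteq> dual (tensor_space V W)"
    using pairing_dual[OF V W] LM by blast
  fix s t assume s: "s \<in> carr (tensor_space V W)" and t: "t \<in> carr (tensor_space V W)"
    and "\<forall>\<omega>\<in>{pairing V W \<phi> \<psi> | \<phi> \<psi>. \<phi> \<in> L \<and> \<psi> \<in> M}. \<omega> s = \<omega> t"
  hence eq: "pairing V W \<phi> \<psi> s = pairing V W \<phi> \<psi> t" if "\<phi> \<in> L" "\<psi> \<in> M" for \<phi> \<psi>
    using that by blast
  obtain ps qs where ps: "represents V W s ps" and qs: "represents V W t qs"
    using represents_exists[OF V W] s t by metis
  \<comment> \<open>\<open>(\<phi> \<otimes> id) s = (\<phi> \<otimes> id) t\<close> for the functionals in \<open>L\<close>\<close>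
  have contract2: "(\<Sum>p\<leftarrow>ps. smul W (\<phi> (fst p)) (snd p)) = (\<Sum>p\<leftarrow>qs. smul W (\<phi> (fst p)) (snd p))"
    if \<phi>: "\<phi> \<in> L" for \<phi>
  proof -
    have memb: "smul W (\<phi> (fst p)) (snd p) \<in> carr W" if "represents V W u us" "p \<in> set us" for u us p
      using that is_vspaceD(3)[OF W] representsD[OF that(1)] by (cases p) auto
    have val: "\<psi> (\<Sum>p\<leftarrow>us. smul W (\<phi> (fst p)) (snd p)) = pairing V W \<phi> \<psi> u"
      if "represents V W u us" "\<psi> \<in> dual W" for u us \<psi>
    proof -
      have "\<psi> (\<Sum>p\<leftarrow>us. smul W (\<phi> (fst p)) (snd p)) = (\<Sum>p\<leftarrow>us. \<psi> (smul W (\<phi> (fst p)) (snd p)))"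
        using memb that by (intro dual_list_sum[OF W]) blast+
      also have "\<dots> = (\<Sum>p\<leftarrow>us. \<phi> (fst p) * \<psi> (snd p))"
        using that representsD[OF that(1)]
        by (intro arg_cong[of _ _ sum_list] map_cong refl) (auto intro!: dual_scale)
      also have "\<dots> = pairing V W \<phi> \<psi> u"
        using pairing_represents[OF V W _ that(2,1)] \<phi> LM by (auto simp: case_prod_unfold)
      finally show ?thesis .
    qed
    have "(\<Sum>p\<leftarrow>us. smul W (\<phi> (fst p)) (snd p)) \<in> carr W" if "represents V W u us" for u us
      using memb that by (intro is_vspace_sum_list[OF W]) blast
    moreover have "\<psi> (\<Sum>p\<leftarrow>ps. smul W (\<phi> (fst p)) (snd p)) = \<psi> (\<Sum>p\<leftarrow>qs. smul W (\<phi> (fst p)) (snd p))"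
      if "\<psi> \<in> M" for \<psi>
      using val[OF ps] val[OF qs] eq[OF \<phi> that] that LM by auto
    ultimately show ?thesis using ps qs by (intro separatingD[OF M]) auto
  qed
  \<comment> \<open>\<open>(id \<otimes> \<psi>) s = (id \<otimes> \<psi>) t\<close> for all linear \<open>\<psi>\<close>, since \<open>\<phi> ((id \<otimes> \<psi>) s) = \<psi> ((\<phi> \<otimes> id) s)\<close>\<close>
  have contract1: "(\<Sum>p\<leftarrow>ps. smul V (\<psi> (snd p)) (fst p)) = (\<Sum>p\<leftarrow>qs. smul V (\<psi> (snd p)) (fst p))"
    if \<psi>: "\<psi> \<in> dual W" for \<psi>
  proof -
    have memb: "smul V (\<psi> (snd p)) (fst p) \<in> carr V" if "represents V W u us" "p \<in> set us" for u us p
      using that is_vspaceD(3)[OF V] representsD[OF that(1)] by (cases p) auto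
    have val: "\<phi> (\<Sum>p\<leftarrow>us. smul V (\<psi> (snd p)) (fst p)) = \<psi> (\<Sum>p\<leftarrow>us. smul W (\<phi> (fst p)) (snd p))"
      if "represents V W u us" "\<phi> \<in> dual V" for u us \<phi>
    proof -
      have "\<phi> (\<Sum>p\<leftarrow>us. smul V (\<psi> (snd p)) (fst p)) = (\<Sum>p\<leftarrow>us. \<phi> (smul V (\<psi> (snd p)) (fst p)))"
        using memb that by (intro dual_list_sum[OF V]) blast+
      also have "\<dots> = (\<Sum>p\<leftarrow>us. \<psi> (smul W (\<phi> (fst p)) (snd p)))"
        using that \<psi> representsD[OF that(1)]
        by (intro arg_cong[of _ _ sum_list] map_cong refl)
          (auto simp: dual_scale)
      also have "\<dots> = \<psi> (\<Sum>p\<leftarrow>us. smul W (\<phi> (fst p)) (snd p))"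
        using is_vspaceD(3)[OF W] representsD[OF that(1)]
        by (intro dual_list_sum[OF W \<psi>, symmetric]) auto
      finally show ?thesis .
    qed
    have "(\<Sum>p\<leftarrow>us. smul V (\<psi> (snd p)) (fst p)) \<in> carr V" if "represents V W u us" for u us
      using memb that by (intro is_vspace_sum_list[OF V]) blast
    moreover have "\<phi> (\<Sum>p\<leftarrow>ps. smul V (\<psi> (snd p)) (fst p)) = \<phi> (\<Sum>p\<leftarrow>qs. smul V (\<psi> (snd p)) (fst p))"
      if "\<phi> \<in> L" for \<phi>
    proof -
      have \<phi>: "\<phi> \<in> dual V" using that LM by blast
      show ?thesis by (simp only: val[OF ps \<phi>] val[OF qs \<phi>] contract2[OF that])
    qed
    ultimately show ?thesis using ps qs by (intro separatingD[OF L]) auto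
  qed
  \<comment> \<open>Tensors are functions on pairs of functionals; their values are read off from the contractions.\<close>
  have coord: "(\<Sum>(v, w)\<leftarrow>us. tens V W v w) (\<phi>, \<psi>)
      = (if \<phi> \<in> dual V \<and> \<psi> \<in> dual W then \<phi> (\<Sum>p\<leftarrow>us. smul V (\<psi> (snd p)) (fst p)) else 0)"
    if "represents V W u us" for u us \<phi> \<psi>
  proof (cases "\<phi> \<in> dual V \<and> \<psi> \<in> dual W")
    case True
    hence \<phi>: "\<phi> \<in> dual V" by simp
    have "\<phi> (\<Sum>p\<leftarrow>us. smul V (\<psi> (snd p)) (fst p)) = (\<Sum>p\<leftarrow>us. \<phi> (smul V (\<psi> (snd p)) (fst p)))"
      using is_vspaceD(3)[OF V] representsD[OF that]
      by (intro dual_list_sum[OF V \<phi>]) auto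
    also have "\<dots> = (\<Sum>p\<leftarrow>us. tens V W (fst p) (snd p) (\<phi>, \<psi>))"
      using True representsD[OF that]
      by (intro arg_cong[of _ _ sum_list] map_cong refl)
        (auto simp: tens_def dual_scale)
    finally show ?thesis using True by (simp add: sum_list_fun_apply case_prod_unfold)
  next
    case False
    hence "(\<Sum>(v, w)\<leftarrow>us. tens V W v w) (\<phi>, \<psi>) = (\<Sum>p\<leftarrow>us. 0)"
      unfolding sum_list_fun_apply
      by (intro arg_cong[of _ _ sum_list] map_cong refl) (auto simp: tens_def)
    with False show ?thesis by (auto simp: sum_list_fun_apply)
  qed
  have "s (\<phi>, \<psi>) = t (\<phi>, \<psi>)" for \<phi> \<psi>
    using coord[OF ps] coord[OF qs] contract1[of \<psi>] ps qs by (simp add: represents_def)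
  thus "s = t" by (auto simp: fun_eq_iff)
qed

lemma dual_eqI: "carr V = carr V' \<Longrightarrow> smul V = smul V' \<Longrightarrow> dual V = dual V'"
  by (simp add: dual_def linear_map_def)

lemma tens_eqI:
  assumes "carr V = carr V'" "smul V = smul V'" "carr W = carr W'" "smul W = smul W'"
  shows "tens V W = tens V' W'"
  using dual_eqI[OF assms(1,2)] dual_eqI[OF assms(3,4)] by (simp add: tens_def[abs_def])

text \<open>
  The double Sweedler sums \<open>\<Sum> \<gamma> b\<^sub>1 b\<^sub>2 c\<^sub>1 c\<^sub>2\<close> that describe the coalgebra \<open>B \<otimes> C\<close>.
\<close>

lemma bilinear_map_double_lift:
  assumes V: "is_vspace V" and W: "is_vspace W" and X: "is_vspace X"
    and \<gamma>W: "\<And>v v'. v \<in> carr V \<Longrightarrow> v' \<in> carr V \<Longrightarrow> bilinear_map W W X (\<gamma> v v')"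
    and \<gamma>V: "\<And>w w'. w \<in> carr W \<Longrightarrow> w' \<in> carr W \<Longrightarrow> bilinear_map V V X (\<lambda>v v'. \<gamma> v v' w w')"
  shows "t \<in> carr (tensor_space W W)
      \<Longrightarrow> bilinear_map V V X (\<lambda>v v'. tensor_lift W W (\<gamma> v v') t)"
    and "bilinear_map (tensor_space V V) (tensor_space W W) X
      (\<lambda>s t. tensor_lift V V (\<lambda>v v'. tensor_lift W W (\<gamma> v v') t) s)"
proof -
  show *: "bilinear_map V V X (\<lambda>v v'. tensor_lift W W (\<gamma> v v') t)"
    if "t \<in> carr (tensor_space W W)" for t
    using that
    by (intro bilinear_mapI linear_map_tensor_lift_param[OF W W X] \<gamma>W V
        bilinear_mapD(1)[OF \<gamma>V] bilinear_mapD(2)[OF \<gamma>V])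
  show "bilinear_map (tensor_space V V) (tensor_space W W) X
      (\<lambda>s t. tensor_lift V V (\<lambda>v v'. tensor_lift W W (\<gamma> v v') t) s)"
    by (intro bilinear_map_tensor_lift[OF V V X is_vspace_tensor_space] *
        tensor_universal(1)[OF W W X] \<gamma>W)
qed

lemma tensor_map_bilinear:
  assumes "is_vspace V'" "is_vspace W'" "linear_map V V' f" "linear_map W W' g"
  shows "bilinear_map V W (tensor_space V' W') (\<lambda>v w. tens V' W' (f v) (g w))"
  using bilinear_map_comp[OF bilinear_map_tens[OF assms(1,2)] assms(3,4)] .

lemma tensor_map_linear:
  assumes "is_vspace V" "is_vspace W" "is_vspace V'" "is_vspace W'"
    "linear_map V V' f" "linear_map W W' g"
  shows "linear_map (tensor_space V W) (tensor_space V' W') (tensor_map V W V' W' f g)"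
  unfolding tensor_map_def
  by (rule tensor_universal(1)[OF assms(1,2) is_vspace_tensor_space tensor_map_bilinear[OF assms(3-6)]])

lemma tensor_map_tens:
  assumes "is_vspace V" "is_vspace W" "is_vspace V'" "is_vspace W'"
    "linear_map V V' f" "linear_map W W' g" "v \<in> carr V" "w \<in> carr W"
  shows "tensor_map V W V' W' f g (tens V W v w) = tens V' W' (f v) (g w)"
  unfolding tensor_map_def
  by (rule tensor_universal(2)[OF assms(1,2) is_vspace_tensor_space tensor_map_bilinear[OF assms(3-6)] assms(7,8)])

lemma tensor_map_cong:
  assumes "\<And>v. v \<in> carr V \<Longrightarrow> f v = f' v" "\<And>w. w \<in> carr W \<Longrightarrow> g w = g' w"
  shows "tensor_map V W V' W' f g t = tensor_map V W V' W' f' g' t"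
  unfolding tensor_map_def using assms by (intro tensor_lift_cong) simp

lemma tensor_map_comp:
  assumes "is_vspace V" "is_vspace W" "is_vspace V'" "is_vspace W'" "is_vspace V''" "is_vspace W''"
    "linear_map V V' f" "linear_map W W' g" "linear_map V' V'' f'" "linear_map W' W'' g'"
    "t \<in> carr (tensor_space V W)"
  shows "tensor_map V' W' V'' W'' f' g' (tensor_map V W V' W' f g t)
       = tensor_map V W V'' W'' (\<lambda>v. f' (f v)) (\<lambda>w. g' (g w)) t"
proof (rule linear_maps_tensor_eqI[OF assms(1,2) _ _ _ _ assms(11)])
  show "linear_map (tensor_space V W) (tensor_space V'' W'')
      (\<lambda>t. tensor_map V' W' V'' W'' f' g' (tensor_map V W V' W' f g t))"
    by (rule linear_map_comp[OF tensor_map_linear[OF assms(1-4,7,8)] tensor_map_linear[OF assms(3-6,9,10)]])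
  show "linear_map (tensor_space V W) (tensor_space V'' W'')
      (tensor_map V W V'' W'' (\<lambda>v. f' (f v)) (\<lambda>w. g' (g w)))"
    by (intro tensor_map_linear linear_map_comp[OF assms(7,9)] linear_map_comp[OF assms(8,10)] assms)
  fix v w assume "v \<in> carr V" "w \<in> carr W"
  thus "tensor_map V' W' V'' W'' f' g' (tensor_map V W V' W' f g (tens V W v w))
      = tensor_map V W V'' W'' (\<lambda>v. f' (f v)) (\<lambda>w. g' (g w)) (tens V W v w)"
    using linear_mapD(1)[OF assms(7)] linear_mapD(1)[OF assms(8)]
    by (simp add: tensor_map_tens assms linear_map_comp[OF assms(7,9)] linear_map_comp[OF assms(8,10)])
qed (rule is_vspace_tensor_space)

lemma pairing_tensor_map:
  assumes "is_vspace V" "is_vspace W" "is_vspace V'" "is_vspace W'"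
    "linear_map V V' f" "linear_map W W' g" "\<phi> \<in> dual V'" "\<psi> \<in> dual W'"
    "t \<in> carr (tensor_space V W)"
  shows "pairing V' W' \<phi> \<psi> (tensor_map V W V' W' f g t)
       = pairing V W (\<lambda>v. \<phi> (f v)) (\<lambda>w. \<psi> (g w)) t"
proof -
  have "linear_map (tensor_space V' W') base_field (pairing V' W' \<phi> \<psi>)"
    using pairing_dual[OF assms(3,4,7,8)] by (simp add: dual_def)
  hence "pairing V' W' \<phi> \<psi> (tensor_map V W V' W' f g t)
      = tensor_lift V W (\<lambda>v w. pairing V' W' \<phi> \<psi> (tens V' W' (f v) (g w))) t"
    unfolding tensor_map_def
    by (intro linear_map_tensor_lift[OF assms(1,2) is_vspace_tensor_space is_vspace_base_field
          tensor_map_bilinear[OF assms(3-6)] _ assms(9)])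
  also have "\<dots> = pairing V W (\<lambda>v. \<phi> (f v)) (\<lambda>w. \<psi> (g w)) t"
    unfolding pairing_def[of V W]
    by (intro tensor_lift_cong pairing_tens assms linear_mapD(1)[OF assms(5)] linear_mapD(1)[OF assms(6)])
  finally show ?thesis .
qed

lemma tensor_assoc_bilinear:
  assumes U: "is_vspace U" and V: "is_vspace V" and W: "is_vspace W"
  shows "w \<in> carr W \<Longrightarrow> bilinear_map U V (tensor_space U (tensor_space V W))
      (\<lambda>u v. tens U (tensor_space V W) u (tens V W v w))"
    and "bilinear_map (tensor_space U V) W (tensor_space U (tensor_space V W))
      (\<lambda>t w. tensor_lift U V (\<lambda>u v. tens U (tensor_space V W) u (tens V W v w)) t)"
proof -
  note T = bilinear_map_tens[OF U is_vspace_tensor_space[of V W]]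
  show *: "bilinear_map U V (tensor_space U (tensor_space V W))
      (\<lambda>u v. tens U (tensor_space V W) u (tens V W v w))" if "w \<in> carr W" for w
    by (rule bilinear_map_comp[OF T linear_map_ident bilinear_mapD(2)[OF bilinear_map_tens[OF V W] that]])
  have "linear_map W (tensor_space U (tensor_space V W))
      (\<lambda>w. tens U (tensor_space V W) u (tens V W v w))" if "u \<in> carr U" "v \<in> carr V" for u v
    by (rule linear_map_comp[OF bilinear_mapD(1)[OF bilinear_map_tens[OF V W] that(2)]
          bilinear_mapD(1)[OF T that(1)]])
  with * show "bilinear_map (tensor_space U V) W (tensor_space U (tensor_space V W))
      (\<lambda>t w. tensor_lift U V (\<lambda>u v. tens U (tensor_space V W) u (tens V W v w)) t)"
    by (intro bilinear_map_tensor_lift[OF U V is_vspace_tensor_space W])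
qed

lemma tensor_assoc_linear:
  assumes "is_vspace U" "is_vspace V" "is_vspace W"
  shows "linear_map (tensor_space (tensor_space U V) W) (tensor_space U (tensor_space V W))
           (tensor_assoc U V W)"
  unfolding tensor_assoc_def
  by (rule tensor_universal(1)[OF is_vspace_tensor_space assms(3) is_vspace_tensor_space
        tensor_assoc_bilinear(2)[OF assms]])

text \<open>
  The associator is transposed to the rebracketing \<open>(\<phi> \<otimes> \<psi>) \<otimes> \<chi> \<mapsto> \<phi> \<otimes> (\<psi> \<otimes> \<chi>)\<close>; on a
  pure tensor both sides are the product of the three values.
\<close>

lemma pairing_tensor_assoc:
  assumes U: "is_vspace U" and V: "is_vspace V" and W: "is_vspace W"
    and \<phi>: "\<phi> \<in> dual U" and \<psi>: "\<psi> \<in> dual V" and \<chi>: "\<chi> \<in> dual W"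
    and t: "t \<in> carr (tensor_space (tensor_space U V) W)"
  shows "pairing U (tensor_space V W) \<phi> (pairing V W \<psi> \<chi>) (tensor_assoc U V W t)
       = pairing (tensor_space U V) W (pairing U V \<phi> \<psi>) \<chi> t"
proof (rule linear_maps_tensor_eqI[OF is_vspace_tensor_space W is_vspace_base_field _ _ _ t])
  have P: "linear_map (tensor_space U (tensor_space V W)) base_field
      (pairing U (tensor_space V W) \<phi> (pairing V W \<psi> \<chi>))"
    using pairing_dual[OF U is_vspace_tensor_space \<phi> pairing_dual[OF V W \<psi> \<chi>]] by (simp add: dual_def)
  thus "linear_map (tensor_space (tensor_space U V) W) base_field
     (\<lambda>t. pairing U (tensor_space V W) \<phi> (pairing V W \<psi> \<chi>) (tensor_assoc U V W t))"
    by (rule linear_map_comp[OF tensor_assoc_linear[OF U V W]])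
  show "linear_map (tensor_space (tensor_space U V) W) base_field
     (pairing (tensor_space U V) W (pairing U V \<phi> \<psi>) \<chi>)"
    using pairing_dual[OF is_vspace_tensor_space W pairing_dual[OF U V \<phi> \<psi>] \<chi>] by (simp add: dual_def)
  fix s w assume s: "s \<in> carr (tensor_space U V)" and w: "w \<in> carr W"
  have "pairing U (tensor_space V W) \<phi> (pairing V W \<psi> \<chi>)
          (tensor_assoc U V W (tens (tensor_space U V) W s w))
      = pairing U (tensor_space V W) \<phi> (pairing V W \<psi> \<chi>)
          (tensor_lift U V (\<lambda>u v. tens U (tensor_space V W) u (tens V W v w)) s)"
    unfolding tensor_assoc_def
    by (simp only: tensor_universal(2)[OF is_vspace_tensor_space W is_vspace_tensor_space
          tensor_assoc_bilinear(2)[OF U V W] s w])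
  also have "\<dots> = tensor_lift U V (\<lambda>u v. pairing U (tensor_space V W) \<phi> (pairing V W \<psi> \<chi>)
                     (tens U (tensor_space V W) u (tens V W v w))) s"
    by (rule linear_map_tensor_lift[OF U V is_vspace_tensor_space is_vspace_base_field
          tensor_assoc_bilinear(1)[OF U V W w] P s])
  also have "\<dots> = tensor_lift U V (\<lambda>u v. \<phi> u * \<psi> v * \<chi> w) s"
    using w by (intro tensor_lift_cong) (simp add: pairing_tens[OF U is_vspace_tensor_space \<phi> pairing_dual[OF V W \<psi> \<chi>]]
        pairing_tens[OF V W \<psi> \<chi>] tens_in_tensor_space[OF V W])
  also have "\<dots> = pairing U V \<phi> \<psi> s * \<chi> w"
  proof -
    have "linear_map base_field base_field (\<lambda>x. x * \<chi> w)"
      by (simp add: linear_map_def base_field_def algebra_simps)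
    thus ?thesis
      unfolding pairing_def
      by (intro linear_map_tensor_lift[OF U V is_vspace_base_field is_vspace_base_field
            bilinear_map_functionals[OF \<phi> \<psi>] _ s, symmetric])
  qed
  also have "\<dots> = pairing (tensor_space U V) W (pairing U V \<phi> \<psi>) \<chi> (tens (tensor_space U V) W s w)"
    by (rule pairing_tens[OF is_vspace_tensor_space W pairing_dual[OF U V \<phi> \<psi>] \<chi> s w, symmetric])
  finally show "pairing U (tensor_space V W) \<phi> (pairing V W \<psi> \<chi>)
          (tensor_assoc U V W (tens (tensor_space U V) W s w))
      = pairing (tensor_space U V) W (pairing U V \<phi> \<psi>) \<chi> (tens (tensor_space U V) W s w)" .
qed


section \<open>The convolution algebra of a coalgebra\<close>

definition conv ::
  "('k::field, 'c::ab_group_add) coalg \<Rightarrow> ('c \<Rightarrow> 'k) \<Rightarrow> ('c \<Rightarrow> 'k) \<Rightarrow> 'c \<Rightarrow> 'k" where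
  "conv C \<phi> \<psi> c = pairing C C \<phi> \<psi> (comult C c)"

lemma conv_dual:
  assumes "is_vspace C" "linear_map C (tensor_space C C) (comult C)" "\<phi> \<in> dual C" "\<psi> \<in> dual C"
  shows "conv C \<phi> \<psi> \<in> dual C"
  using dual_comp[OF assms(2) pairing_dual[OF assms(1,1,3,4)]] by (simp add: conv_def[abs_def])

lemma conv_cong:
  assumes "\<And>c. c \<in> carr C \<Longrightarrow> \<phi> c = \<phi>' c" "\<And>c. c \<in> carr C \<Longrightarrow> \<psi> c = \<psi>' c"
  shows "conv C \<phi> \<psi> c = conv C \<phi>' \<psi>' c"
  unfolding conv_def pairing_def using assms by (intro tensor_lift_cong) simp

text \<open>
  The two triple coproducts are dual to the two bracketings of a convolution product, so
  coassociativity passes to and fro between a coalgebra and its convolution algebra.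
\<close>

lemma conv_conv:
  assumes C: "is_vspace C" and \<Delta>: "linear_map C (tensor_space C C) (comult C)"
    and \<phi>: "\<phi> \<in> dual C" and \<psi>: "\<psi> \<in> dual C" and \<chi>: "\<chi> \<in> dual C" and c: "c \<in> carr C"
  shows "pairing C (tensor_space C C) \<phi> (pairing C C \<psi> \<chi>)
      (tensor_assoc C C C (tensor_map C C (tensor_space C C) C (comult C) id (comult C c)))
      = conv C (conv C \<phi> \<psi>) \<chi> c" (is "?left = _")
    and "pairing C (tensor_space C C) \<phi> (pairing C C \<psi> \<chi>)
      (tensor_map C C C (tensor_space C C) id (comult C) (comult C c))
      = conv C \<phi> (conv C \<psi> \<chi>) c"
proof -
  note T = is_vspace_tensor_space[of C C]
  have t: "comult C c \<in> carr (tensor_space C C)" using linear_mapD(1)[OF \<Delta> c] .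
  have id: "linear_map C C id" using linear_map_ident by (simp add: id_def)
  have "?left = pairing (tensor_space C C) C (pairing C C \<phi> \<psi>) \<chi>
      (tensor_map C C (tensor_space C C) C (comult C) id (comult C c))"
    by (intro pairing_tensor_assoc[OF C C C \<phi> \<psi> \<chi>] linear_mapD(1)[OF tensor_map_linear[OF C C T C \<Delta> id] t])
  also have "\<dots> = conv C (conv C \<phi> \<psi>) \<chi> c"
    using pairing_tensor_map[OF C C T C \<Delta> id pairing_dual[OF C C \<phi> \<psi>] \<chi> t]
    by (simp add: conv_def[abs_def])
  finally show "?left = conv C (conv C \<phi> \<psi>) \<chi> c" .
  show "pairing C (tensor_space C C) \<phi> (pairing C C \<psi> \<chi>)
      (tensor_map C C C (tensor_space C C) id (comult C) (comult C c))
      = conv C \<phi> (conv C \<psi> \<chi>) c"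
    using pairing_tensor_map[OF C C C T id \<Delta> \<phi> pairing_dual[OF C C \<psi> \<chi>] t]
    by (simp add: conv_def[abs_def])
qed

lemma coalgebraD:
  assumes "coalgebra C"
  shows "is_vspace C" "linear_map C (tensor_space C C) (comult C)" "counit C \<in> dual C"
    "c \<in> carr C \<Longrightarrow> tensor_lift C C (\<lambda>x y. smul C (counit C x) y) (comult C c) = c"
    "c \<in> carr C \<Longrightarrow> comult C c \<in> carr (tensor_space C C)"
  using assms by (auto simp: coalgebra_def dual_def dest: linear_mapD(1))

lemma conv_assoc:
  assumes "coalgebra C" "\<phi> \<in> dual C" "\<psi> \<in> dual C" "\<chi> \<in> dual C" "c \<in> carr C"
  shows "conv C (conv C \<phi> \<psi>) \<chi> c = conv C \<phi> (conv C \<psi> \<chi>) c"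
proof -
  have "tensor_assoc C C C (tensor_map C C (tensor_space C C) C (comult C) id (comult C c)) =
        tensor_map C C C (tensor_space C C) id (comult C) (comult C c)"
    using assms(1,5) by (simp add: coalgebra_def)
  thus ?thesis
    using conv_conv[OF coalgebraD(1,2)[OF assms(1)] assms(2-5)] by simp
qed

lemma conv_counit_left:
  assumes C: "coalgebra C" and \<phi>: "\<phi> \<in> dual C" and c: "c \<in> carr C"
  shows "conv C (counit C) \<phi> c = \<phi> c"
proof -
  note V = coalgebraD(1)[OF C]
  have \<beta>: "bilinear_map C C C (\<lambda>x y. smul C (counit C x) y)"
    using bilinear_map_comp[OF bilinear_map_smul[OF V] _ linear_map_ident, of C "counit C"]
      coalgebraD(3)[OF C] by (simp add: dual_def)
  have "\<phi> c = \<phi> (tensor_lift C C (\<lambda>x y. smul C (counit C x) y) (comult C c))"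
    using coalgebraD(4)[OF C c] by simp
  also have "\<dots> = tensor_lift C C (\<lambda>x y. \<phi> (smul C (counit C x) y)) (comult C c)"
    using \<phi> by (intro linear_map_tensor_lift[OF V V V is_vspace_base_field \<beta> _ coalgebraD(5)[OF C c]])
      (simp add: dual_def)
  also have "\<dots> = conv C (counit C) \<phi> c"
    unfolding conv_def pairing_def by (intro tensor_lift_cong dual_scale[OF \<phi>])
  finally show ?thesis by simp
qed

lemma conv_counit_right:
  assumes C: "coalgebra C" and \<phi>: "\<phi> \<in> dual C" and c: "c \<in> carr C"
  shows "conv C \<phi> (counit C) c = \<phi> c"
proof -
  note V = coalgebraD(1)[OF C]
  have \<beta>: "bilinear_map C C C (\<lambda>x y. smul C (counit C y) x)"
    using bilinear_map_comp[OF bilinear_map_smul[OF V] _ linear_map_ident, of C "counit C"]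
      coalgebraD(3)[OF C] by (simp add: dual_def bilinear_map_def)
  have "tensor_lift C C (\<lambda>x y. smul C (counit C y) x) (comult C c) = c"
    using C c by (simp add: coalgebra_def)
  hence "\<phi> c = \<phi> (tensor_lift C C (\<lambda>x y. smul C (counit C y) x) (comult C c))" by simp
  also have "\<dots> = tensor_lift C C (\<lambda>x y. \<phi> (smul C (counit C y) x)) (comult C c)"
    using \<phi> by (intro linear_map_tensor_lift[OF V V V is_vspace_base_field \<beta> _ coalgebraD(5)[OF C c]])
      (simp add: dual_def)
  also have "\<dots> = conv C \<phi> (counit C) c"
    unfolding conv_def pairing_def
    by (intro tensor_lift_cong) (simp add: dual_scale[OF \<phi>] mult.commute)
  finally show ?thesis by simp
qed

lemma coalgebra_mapD:
  assumes "coalgebra_map C D F"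
  shows "linear_map C D F" "c \<in> carr C \<Longrightarrow> comult D (F c) = tensor_map C C D D F F (comult C c)"
    "c \<in> carr C \<Longrightarrow> counit D (F c) = counit C c"
  using assms by (auto simp: coalgebra_map_def)

lemma conv_coalgebra_map:
  assumes "coalgebra C" "coalgebra D" "coalgebra_map C D F" "\<phi> \<in> dual D" "\<psi> \<in> dual D" "c \<in> carr C"
  shows "conv D \<phi> \<psi> (F c) = conv C (\<lambda>x. \<phi> (F x)) (\<lambda>x. \<psi> (F x)) c"
  unfolding conv_def
  using pairing_tensor_map[OF coalgebraD(1)[OF assms(1)] coalgebraD(1)[OF assms(1)]
      coalgebraD(1)[OF assms(2)] coalgebraD(1)[OF assms(2)]
      coalgebra_mapD(1)[OF assms(3)] coalgebra_mapD(1)[OF assms(3)] assms(4,5) coalgebraD(5)[OF assms(1,6)]]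
    coalgebra_mapD(2)[OF assms(3,6)] by simp

lemma coalgebra_map_cong:
  assumes "coalgebra C" "\<And>c. c \<in> carr C \<Longrightarrow> F c = G c"
  shows "coalgebra_map C D F \<longleftrightarrow> coalgebra_map C D G"
proof -
  have "tensor_map C C D D F F t = tensor_map C C D D G G t" for t
    using assms(2) by (intro tensor_map_cong) auto
  thus ?thesis
    unfolding coalgebra_map_def using assms(2) linear_map_cong[OF coalgebraD(1)[OF assms(1)], of F G D]
    by auto
qed

lemma coalgebra_map_ident:
  assumes "coalgebra C"
  shows "coalgebra_map C C (\<lambda>c. c)"
proof -
  note V = coalgebraD(1)[OF assms]
  have "tensor_map C C C C (\<lambda>c. c) (\<lambda>c. c) t = t" if "t \<in> carr (tensor_space C C)" for t
    by (rule linear_maps_tensor_eqI[OF V V is_vspace_tensor_space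
          tensor_map_linear[OF V V V V linear_map_ident linear_map_ident] linear_map_ident _ that])
      (rule tensor_map_tens[OF V V V V linear_map_ident linear_map_ident])
  thus ?thesis
    using coalgebraD(5)[OF assms] linear_map_ident by (simp add: coalgebra_map_def)
qed

lemma coalgebra_map_comp:
  assumes "coalgebra C" "coalgebra D" "coalgebra E" "coalgebra_map C D F" "coalgebra_map D E G"
  shows "coalgebra_map C E (\<lambda>c. G (F c))"
proof -
  note V = assms(1-3)[THEN coalgebraD(1)]
  note L = coalgebra_mapD(1)[OF assms(4)] coalgebra_mapD(1)[OF assms(5)]
  have "comult E (G (F c)) = tensor_map C C E E (\<lambda>c. G (F c)) (\<lambda>c. G (F c)) (comult C c)"
    if "c \<in> carr C" for c
    using tensor_map_comp[OF V(1,1,2,2,3,3) L(1,1,2,2) coalgebraD(5)[OF assms(1) that]]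
      coalgebra_mapD(2)[OF assms(4) that] coalgebra_mapD(2)[OF assms(5) linear_mapD(1)[OF L(1) that]]
    by simp
  moreover have "counit E (G (F c)) = counit C c" if "c \<in> carr C" for c
    using coalgebra_mapD(3)[OF assms(4) that] coalgebra_mapD(3)[OF assms(5) linear_mapD(1)[OF L(1) that]]
    by simp
  ultimately show ?thesis
    using linear_map_comp[OF L] by (simp add: coalgebra_map_def)
qed


section \<open>Partial coverings as bilinear maps\<close>

lemma bialgebraD:
  assumes "bialgebra A"
  shows "coalgebra A" "carr A = UNIV" "bilinear_map A A A (*)"
    "is_vspace A" "linear_map A (tensor_space A A) (comult A)" "counit A \<in> dual A"
    "comult A x \<in> carr (tensor_space A A)"
  using assms coalgebraD(1,2,3,5)[of A]
  by (auto simp: bialgebra_def bilinear_map_def linear_map_def algebra_simps)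

text \<open>
  A partial covering \<open>f\<close> is determined by \<open>g b c = f (b \<otimes> c)\<close>, and its axioms are written
  here for \<open>g\<close>. In this form the tensor coalgebra \<open>B \<otimes> C\<close> has disappeared, and the conditions
  are identities between Sweedler sums of \<open>b\<close> and of \<open>c\<close>.
\<close>

definition covering_form ::
  "('k::field, 'b::ring_1) coalg \<Rightarrow> ('k, 'c::ab_group_add) coalg \<Rightarrow> ('k, 'a::ring_1) coalg
    \<Rightarrow> ('b \<Rightarrow> 'c \<Rightarrow> 'a) \<Rightarrow> bool" where
  "covering_form B C A g \<longleftrightarrow>
     bilinear_map B C A g \<and>
     (\<forall>b b'. \<forall>c\<in>carr C.
        g (b * b') c = tensor_lift C C (\<lambda>x y. g b x * g b' y) (comult C c)) \<and>
     (\<forall>c\<in>carr C. g 1 c = smul A (counit C c) 1) \<and>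
     (\<forall>b. \<forall>c\<in>carr C. comult A (g b c) =
        tensor_lift B B (\<lambda>b\<^sub>1 b\<^sub>2. tensor_lift C C (\<lambda>x y. tens A A (g b\<^sub>1 x) (g b\<^sub>2 y)) (comult C c))
          (comult B b)) \<and>
     (\<forall>b. \<forall>c\<in>carr C. counit A (g b c) = counit B b * counit C c)"

lemma covering_formD:
  assumes "covering_form B C A g" "c \<in> carr C"
  shows "g (b * b') c = tensor_lift C C (\<lambda>x y. g b x * g b' y) (comult C c)"
    "g 1 c = smul A (counit C c) 1"
    "comult A (g b c) = tensor_lift B B (\<lambda>b\<^sub>1 b\<^sub>2.
       tensor_lift C C (\<lambda>x y. tens A A (g b\<^sub>1 x) (g b\<^sub>2 y)) (comult C c)) (comult B b)"
    "counit A (g b c) = counit B b * counit C c"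
  using assms unfolding covering_form_def by blast+

lemma covering_form_quadrilinear:
  assumes "is_vspace B" "is_vspace C" "is_vspace A" "bilinear_map B C A g"
  shows "b \<in> carr B \<Longrightarrow> b' \<in> carr B \<Longrightarrow>
      bilinear_map C C (tensor_space A A) (\<lambda>x y. tens A A (g b x) (g b' y))"
    and "x \<in> carr C \<Longrightarrow> y \<in> carr C \<Longrightarrow>
      bilinear_map B B (tensor_space A A) (\<lambda>b b'. tens A A (g b x) (g b' y))"
proof -
  note T = bilinear_map_comp[OF bilinear_map_tens[OF assms(3,3)]]
  show "bilinear_map C C (tensor_space A A) (\<lambda>x y. tens A A (g b x) (g b' y))"
    if "b \<in> carr B" "b' \<in> carr B"
    by (rule T[OF bilinear_mapD(1)[OF assms(4) that(1)] bilinear_mapD(1)[OF assms(4) that(2)]])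
  show "bilinear_map B B (tensor_space A A) (\<lambda>b b'. tens A A (g b x) (g b' y))"
    if "x \<in> carr C" "y \<in> carr C"
    by (rule T[OF bilinear_mapD(2)[OF assms(4) that(1)] bilinear_mapD(2)[OF assms(4) that(2)]])
qed

lemma tensor_coalgebra_comult:
  assumes B: "coalgebra B" and C: "coalgebra C"
  shows "linear_map (tensor_space B C) (tensor_space (tensor_space B C) (tensor_space B C))
      (comult (tensor_coalgebra B C))"
    and "b \<in> carr B \<Longrightarrow> c \<in> carr C \<Longrightarrow> comult (tensor_coalgebra B C) (tens B C b c) =
      tensor_lift B B (\<lambda>b\<^sub>1 b\<^sub>2. tensor_lift C C (\<lambda>c\<^sub>1 c\<^sub>2.
            tens (tensor_space B C) (tensor_space B C) (tens B C b\<^sub>1 c\<^sub>1) (tens B C b\<^sub>2 c\<^sub>2))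
          (comult C c)) (comult B b)"
proof -
  let ?T = "tensor_space B C"
  let ?\<gamma> = "\<lambda>b\<^sub>1 b\<^sub>2 c\<^sub>1 c\<^sub>2. tens ?T ?T (tens B C b\<^sub>1 c\<^sub>1) (tens B C b\<^sub>2 c\<^sub>2)"
  let ?D = "\<lambda>b c. tensor_lift B B (\<lambda>b\<^sub>1 b\<^sub>2. tensor_lift C C (?\<gamma> b\<^sub>1 b\<^sub>2) (comult C c)) (comult B b)"
  note VB = coalgebraD(1)[OF B] and VC = coalgebraD(1)[OF C]
  note T = is_vspace_tensor_space[of B C] and TT = is_vspace_tensor_space[of ?T ?T]
  note \<gamma> = covering_form_quadrilinear[OF VB VC T bilinear_map_tens[OF VB VC]]
  have D: "bilinear_map B C (tensor_space ?T ?T) ?D"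
    by (rule bilinear_map_comp[OF bilinear_map_double_lift(2)[OF VB VC TT \<gamma>] coalgebraD(2)[OF B]
          coalgebraD(2)[OF C]])
  have comult: "comult (tensor_coalgebra B C) = tensor_lift B C ?D" by (simp add: tensor_coalgebra_def)
  show "linear_map ?T (tensor_space ?T ?T) (comult (tensor_coalgebra B C))"
    unfolding comult by (rule tensor_universal(1)[OF VB VC TT D])
  show "comult (tensor_coalgebra B C) (tens B C b c) = ?D b c" if "b \<in> carr B" "c \<in> carr C"
    unfolding comult by (rule tensor_universal(2)[OF VB VC TT D that])
qed

lemma tensor_coalgebra_counit:
  assumes B: "coalgebra B" and C: "coalgebra C"
  shows "counit (tensor_coalgebra B C) = pairing B C (counit B) (counit C)"
  by (simp add: tensor_coalgebra_def pairing_def)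

text \<open>
  Both sides of each coalgebra map axiom are linear on \<open>B \<otimes> C\<close>, so they need to be
  compared on pure tensors only. There the image of the comultiplication of \<open>B \<otimes> C\<close>
  under \<open>f \<otimes> f\<close> is found by moving this linear map inside both lifts.
\<close>

lemma partial_covering_iff:
  fixes B :: "('k::field, 'b::ring_1) coalg" and A :: "('k, 'a::ring_1) coalg"
    and C :: "('k, 'c::ab_group_add) coalg"
  assumes A: "bialgebra A" and B: "bialgebra B" and C: "coalgebra C"
  shows "partial_covering B C A f \<longleftrightarrow>
    linear_map (tensor_space B C) A f \<and> covering_form B C A (\<lambda>b c. f (tens B C b c))"
proof (cases "linear_map (tensor_space B C) A f")
  case False
  thus ?thesis by (simp add: partial_covering_def measuring_def)
next
  case f: True
  let ?T = "tensor_space B C" and ?TC = "tensor_coalgebra B C"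
  let ?g = "\<lambda>b c. f (tens B C b c)"
  note VA = bialgebraD(4)[OF A] and VB = bialgebraD(4)[OF B] and VC = coalgebraD(1)[OF C]
  note T = is_vspace_tensor_space[of B C] and AA = is_vspace_tensor_space[of A A]
  note UB = bialgebraD(2)[OF B]
  have g: "bilinear_map B C A ?g"
    by (rule linear_bilinear_map_comp[OF bilinear_map_tens[OF VB VC] f])
  have lin: "linear_map ?TC A f" using f by (simp add: linear_map_def tensor_coalgebra_def)
  have TC: "carr ?TC = carr ?T" by (simp add: tensor_coalgebra_def)
  have map_eq: "tensor_map ?TC ?TC A A f f = tensor_map ?T ?T A A f f"
  proof -
    have "tens ?TC ?TC = tens ?T ?T" by (intro tens_eqI) (auto simp: tensor_coalgebra_def)
    thus ?thesis by (simp add: tensor_map_def tensor_lift_def[abs_def] TC)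
  qed
  note mapf = tensor_map_linear[OF T T VA VA f f]
  have mapD: "tensor_map ?T ?T A A f f (comult ?TC (tens B C b c)) =
      tensor_lift B B (\<lambda>b\<^sub>1 b\<^sub>2. tensor_lift C C (\<lambda>x y. tens A A (?g b\<^sub>1 x) (?g b\<^sub>2 y)) (comult C c)) (comult B b)"
    if c: "c \<in> carr C" for b c
  proof -
    note \<Delta>c = coalgebraD(5)[OF C c] and \<Delta>b = bialgebraD(7)[OF B, of b]
    note TT = is_vspace_tensor_space[of ?T ?T]
    note \<gamma> = covering_form_quadrilinear[OF VB VC T bilinear_map_tens[OF VB VC]]
    let ?\<gamma> = "\<lambda>b\<^sub>1 b\<^sub>2 c\<^sub>1 c\<^sub>2. tens ?T ?T (tens B C b\<^sub>1 c\<^sub>1) (tens B C b\<^sub>2 c\<^sub>2)"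
    have "tensor_map ?T ?T A A f f (comult ?TC (tens B C b c))
        = tensor_map ?T ?T A A f f (tensor_lift B B (\<lambda>b\<^sub>1 b\<^sub>2. tensor_lift C C (?\<gamma> b\<^sub>1 b\<^sub>2) (comult C c)) (comult B b))"
      using tensor_coalgebra_comult(2)[OF bialgebraD(1)[OF B] C _ c, of b] by (simp add: UB)
    also have "\<dots> = tensor_lift B B (\<lambda>b\<^sub>1 b\<^sub>2. tensor_map ?T ?T A A f f (tensor_lift C C (?\<gamma> b\<^sub>1 b\<^sub>2) (comult C c))) (comult B b)"
      by (rule linear_map_tensor_lift[OF VB VB TT AA bilinear_map_double_lift(1)[OF VB VC TT \<gamma> \<Delta>c] mapf \<Delta>b])
    also have "\<dots> = tensor_lift B B (\<lambda>b\<^sub>1 b\<^sub>2. tensor_lift C C (\<lambda>x y. tensor_map ?T ?T A A f f (?\<gamma> b\<^sub>1 b\<^sub>2 x y)) (comult C c)) (comult B b)"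
      by (intro tensor_lift_cong linear_map_tensor_lift[OF VC VC TT AA \<gamma>(1) mapf \<Delta>c])
    also have "\<dots> = tensor_lift B B (\<lambda>b\<^sub>1 b\<^sub>2. tensor_lift C C (\<lambda>x y. tens A A (?g b\<^sub>1 x) (?g b\<^sub>2 y)) (comult C c)) (comult B b)"
      by (intro tensor_lift_cong tensor_map_tens[OF T T VA VA f f] tens_in_tensor_space[OF VB VC])
    finally show ?thesis .
  qed
  have comult_iff: "(\<forall>t\<in>carr ?TC. comult A (f t) = tensor_map ?TC ?TC A A f f (comult ?TC t)) \<longleftrightarrow>
    (\<forall>b. \<forall>c\<in>carr C. comult A (?g b c) =
        tensor_lift B B (\<lambda>b\<^sub>1 b\<^sub>2. tensor_lift C C (\<lambda>x y. tens A A (?g b\<^sub>1 x) (?g b\<^sub>2 y)) (comult C c))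
          (comult B b))" (is "?L = ?R")
  proof
    assume ?L
    thus ?R using mapD tens_in_tensor_space[OF VB VC] UB unfolding map_eq TC by simp
  next
    assume R: ?R
    show ?L
    proof
      fix t assume "t \<in> carr ?TC"
      hence t: "t \<in> carr ?T" by (simp add: TC)
      show "comult A (f t) = tensor_map ?TC ?TC A A f f (comult ?TC t)"
        unfolding map_eq
      proof (rule linear_maps_tensor_eqI[OF VB VC AA _ _ _ t])
        show "linear_map ?T (tensor_space A A) (\<lambda>t. comult A (f t))"
          by (rule linear_map_comp[OF f bialgebraD(5)[OF A]])
        show "linear_map ?T (tensor_space A A) (\<lambda>t. tensor_map ?T ?T A A f f (comult ?TC t))"
          by (rule linear_map_comp[OF tensor_coalgebra_comult(1)[OF bialgebraD(1)[OF B] C] mapf])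
        fix b c assume "c \<in> carr C"
        thus "comult A (f (tens B C b c)) = tensor_map ?T ?T A A f f (comult ?TC (tens B C b c))"
          using R mapD by simp
      qed
    qed
  qed
  have counit_iff: "(\<forall>t\<in>carr ?TC. counit A (f t) = counit ?TC t) \<longleftrightarrow>
    (\<forall>b. \<forall>c\<in>carr C. counit A (?g b c) = counit B b * counit C c)" (is "?L = ?R")
  proof -
    note \<epsilon>B = bialgebraD(6)[OF B] and \<epsilon>C = coalgebraD(3)[OF C]
    have pure: "counit ?TC (tens B C b c) = counit B b * counit C c" if "c \<in> carr C" for b c
      using pairing_tens[OF VB VC \<epsilon>B \<epsilon>C _ that] UB
        tensor_coalgebra_counit[OF bialgebraD(1)[OF B] C] by simp
    show ?thesis
    proof
      assume ?L
      thus ?R using pure tens_in_tensor_space[OF VB VC] UB by (simp add: TC)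
    next
      assume R: ?R
      show ?L
      proof
        fix t assume "t \<in> carr ?TC"
        hence t: "t \<in> carr ?T" by (simp add: TC)
        show "counit A (f t) = counit ?TC t"
        proof (rule linear_maps_tensor_eqI[OF VB VC is_vspace_base_field _ _ _ t])
          show "linear_map ?T base_field (\<lambda>t. counit A (f t))"
            using dual_comp[OF f bialgebraD(6)[OF A]] by (simp add: dual_def)
          show "linear_map ?T base_field (counit ?TC)"
            using pairing_dual[OF VB VC \<epsilon>B \<epsilon>C] tensor_coalgebra_counit[OF bialgebraD(1)[OF B] C]
            by (simp add: dual_def)
          fix b c assume "c \<in> carr C"
          thus "counit A (f (tens B C b c)) = counit ?TC (tens B C b c)"
            using R pure by simp
        qed
      qed
    qed
  qed
  show ?thesis
    using f g lin UB
    unfolding partial_covering_def measuring_def coalgebra_map_def covering_form_def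
      comult_iff counit_iff by auto
qed

lemma factorization_iff:
  assumes "is_vspace B" "is_vspace C" "is_vspace U" "is_vspace A"
    "linear_map (tensor_space B C) A f" "linear_map (tensor_space B U) A \<Omega>" "linear_map C U F"
  shows "(\<forall>t\<in>carr (tensor_space B C). f t = \<Omega> (tensor_map B C B U id F t)) \<longleftrightarrow>
    (\<forall>b\<in>carr B. \<forall>c\<in>carr C. f (tens B C b c) = \<Omega> (tens B U b (F c)))" (is "?L = ?R")
proof -
  have id: "linear_map B B id" using linear_map_ident by (simp add: id_def)
  have pure: "tensor_map B C B U id F (tens B C b c) = tens B U b (F c)"
    if "b \<in> carr B" "c \<in> carr C" for b c
    using tensor_map_tens[OF assms(1,2,1,3) id assms(7) that] by simp
  show ?thesis
  proof
    assume ?L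
    thus ?R using pure tens_in_tensor_space[OF assms(1,2)] by simp
  next
    assume R: ?R
    show ?L
    proof
      fix t assume t: "t \<in> carr (tensor_space B C)"
      show "f t = \<Omega> (tensor_map B C B U id F t)"
        by (rule linear_maps_tensor_eqI[OF assms(1,2,4,5)
              linear_map_comp[OF tensor_map_linear[OF assms(1,2,1,3) id assms(7)] assms(6)] _ t])
          (use R pure in simp)
    qed
  qed
qed


section \<open>The universal covering coalgebra inside functions on words\<close>

text \<open>
  The action of \<open>b\<close> on a function \<open>h\<close> of words, which is to become the value \<open>\<Omega> (b \<otimes> h)\<close>.
  The values of \<open>h\<close> on one-letter words \<open>(b, \<phi>)\<close> should be those of all functionals
  \<open>\<phi>\<close> at this one element of \<open>A\<close>.
\<close>

definition letter_value :: "('k::field, 'a::ring_1) coalg \<Rightarrow> ('k, 'b, 'a) words \<Rightarrow> 'b \<Rightarrow> 'a" where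
  "letter_value A h b = (THE a. \<forall>\<phi>\<in>dual A. h [(b, \<phi>)] = \<phi> a)"

text \<open>
  The part of the covering conditions that concerns \<open>h\<close> alone. On letters whose second component
  is not a linear functional, the default value \<open>0\<close> keeps a function determined by its \<open>letter_value\<close>s. Since the
  counit will be the value at the empty word, \<open>h []\<close> stands for \<open>\<epsilon> h\<close>.
\<close>

definition admissible ::
  "('k::field, 'b::ring_1) coalg \<Rightarrow> ('k, 'a::ring_1) coalg \<Rightarrow> ('k, 'b, 'a) words \<Rightarrow> bool" where
  "admissible B A h \<longleftrightarrow>
     (\<forall>b \<phi>. h [(b, \<phi>)] = (if \<phi> \<in> dual A then \<phi> (letter_value A h b) else 0)) \<and>
     linear_map B A (letter_value A h) \<and>
     letter_value A h 1 = smul A (h []) 1 \<and>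
     (\<forall>b. counit A (letter_value A h b) = counit B b * h [])"

text \<open>
  The list \<open>ps\<close> is a candidate for \<open>\<Delta> h\<close>: it splits the values of \<open>h\<close> along concatenation of words,
  and the covering conditions that involve \<open>\<Delta> h\<close> hold for it.
\<close>

definition splits ::
  "('k::field, 'b::ring_1) coalg \<Rightarrow> ('k, 'a::ring_1) coalg \<Rightarrow> ('k, 'b, 'a) words
    \<Rightarrow> (('k, 'b, 'a) words \<times> ('k, 'b, 'a) words) list \<Rightarrow> bool" where
  "splits B A h ps \<longleftrightarrow>
     (\<forall>u v. h (u @ v) = (\<Sum>(x, y)\<leftarrow>ps. x u * y v)) \<and>
     (\<forall>b b'. letter_value A h (b * b') = (\<Sum>(x, y)\<leftarrow>ps. letter_value A x b * letter_value A y b')) \<and>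
     (\<forall>b. comult A (letter_value A h b) = (\<Sum>(x, y)\<leftarrow>ps.
        tensor_lift B B (\<lambda>b\<^sub>1 b\<^sub>2. tens A A (letter_value A x b\<^sub>1) (letter_value A y b\<^sub>2)) (comult B b)))"

text \<open>
  The sets on which a comultiplication can be defined without leaving the set. Since they are mere
  sets and not subspaces, the image of a coalgebra or a set of sums is easily seen to be one of them.
\<close>

definition split_closed ::
  "('k::field, 'b::ring_1) coalg \<Rightarrow> ('k, 'a::ring_1) coalg \<Rightarrow> ('k, 'b, 'a) words set \<Rightarrow> bool" where
  "split_closed B A D \<longleftrightarrow>
     (\<forall>h\<in>D. admissible B A h \<and> (\<exists>ps. set ps \<subseteq> D \<times> D \<and> splits B A h ps))"

text \<open>
  The union is itself split-closed, hence the greatest such set; membership is shown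
  by exhibiting one split-closed set around the given function.
\<close>

definition universal_carrier ::
  "('k::field, 'b::ring_1) coalg \<Rightarrow> ('k, 'a::ring_1) coalg \<Rightarrow> ('k, 'b, 'a) words set" where
  "universal_carrier B A = \<Union>{D. split_closed B A D}"

text \<open>
  The comultiplication is dual to concatenation of words and the counit is evaluation at the
  empty word, as for the representative functions on a monoid. The underlying space \<open>V\<close> is named because tensors over the
  coalgebra are needed before it is defined; they depend only on the carrier and the scalars.
\<close>

definition representative_coalgebra ::
  "('k::field, 'b::ring_1) coalg \<Rightarrow> ('k, 'a::ring_1) coalg \<Rightarrow> ('k, ('k, 'b, 'a) words) coalg" where
  "representative_coalgebra B A =
    (let V = \<lparr>carr = universal_carrier B A, smul = pointwise_smul\<rparr> in
     \<lparr>carr = universal_carrier B A, smul = pointwise_smul,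
      comult = (\<lambda>h. \<Sum>(x, y)\<leftarrow>(SOME ps. set ps \<subseteq> universal_carrier B A \<times> universal_carrier B A \<and>
                                       splits B A h ps). tens V V x y),
      counit = (\<lambda>h. h [])\<rparr>)"

definition representative_covering ::
  "('k::field, 'b::ring_1) coalg \<Rightarrow> ('k, 'a::ring_1) coalg
    \<Rightarrow> ('k, 'b, ('k, 'b, 'a) words) tensor \<Rightarrow> 'a" where
  "representative_covering B A =
     tensor_lift B (representative_coalgebra B A) (\<lambda>b h. letter_value A h b)"

text \<open>
  Linear functionals separate the points of \<open>A\<close>, so there is at most one such element.
\<close>

lemma letter_value_eqI:
  assumes "bialgebra A" "\<And>\<phi>. \<phi> \<in> dual A \<Longrightarrow> h [(b, \<phi>)] = \<phi> a"
  shows "letter_value A h b = a"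
  unfolding letter_value_def
proof (rule the_equality)
  show "\<forall>\<phi>\<in>dual A. h [(b, \<phi>)] = \<phi> a" using assms(2) by blast
  fix a' assume "\<forall>\<phi>\<in>dual A. h [(b, \<phi>)] = \<phi> a'"
  thus "a' = a"
    using assms(2) by (intro dual_separates[OF bialgebraD(4)[OF assms(1)]]) (auto simp: bialgebraD(2)[OF assms(1)])
qed

lemma admissibleD:
  assumes "admissible B A h"
  shows "\<phi> \<in> dual A \<Longrightarrow> h [(b, \<phi>)] = \<phi> (letter_value A h b)"
    "\<phi> \<notin> dual A \<Longrightarrow> h [(b, \<phi>)] = 0"
    "linear_map B A (letter_value A h)"
    "letter_value A h 1 = smul A (h []) 1"
    "counit A (letter_value A h b) = counit B b * h []"
  using assms unfolding admissible_def by (simp_all del: split_paired_All)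

lemma letter_value_zero:
  assumes "bialgebra A"
  shows "letter_value A 0 b = 0"
  using linear_map_0[OF bialgebraD(4)[OF assms]]
  by (intro letter_value_eqI[OF assms]) (simp add: dual_def)

lemma letter_value_linear:
  assumes A: "bialgebra A" and h: "admissible B A h" and h': "admissible B A h'"
  shows "letter_value A (h + h') b = letter_value A h b + letter_value A h' b"
    and "letter_value A (pointwise_smul r h) b = smul A r (letter_value A h b)"
proof -
  have [simp]: "carr A = UNIV" by (rule bialgebraD(2)[OF A])
  show "letter_value A (h + h') b = letter_value A h b + letter_value A h' b"
    using admissibleD(1)[OF h] admissibleD(1)[OF h']
    by (intro letter_value_eqI[OF A]) (simp add: dual_add)
  show "letter_value A (pointwise_smul r h) b = smul A r (letter_value A h b)"
    using admissibleD(1)[OF h]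
    by (intro letter_value_eqI[OF A]) (simp add: dual_scale pointwise_smul_def)
qed

lemma admissible_zero:
  assumes A: "bialgebra A"
  shows "admissible B A 0"
proof -
  interpret A: vector_space "smul A" using bialgebraD(4)[OF A] by (rule is_vspaceD)
  have "carr A = UNIV" by (rule bialgebraD(2)[OF A])
  thus ?thesis
    using bialgebraD(6)[OF A] linear_map_0[OF bialgebraD(4)[OF A], of base_field]
    by (auto simp: admissible_def letter_value_zero[OF A] linear_map_def dual_def)
qed

lemma admissible_closed:
  assumes A: "bialgebra A" and h: "admissible B A h" and h': "admissible B A h'"
  shows "admissible B A (h + h')" and "admissible B A (pointwise_smul r h)"
proof -
  interpret A: vector_space "smul A" using bialgebraD(4)[OF A] by (rule is_vspaceD)
  have [simp]: "carr A = UNIV" by (rule bialgebraD(2)[OF A])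
  note lv = letter_value_linear[OF A h h']
  note \<epsilon> = bialgebraD(6)[OF A]
  note L = admissibleD(3)[OF h] admissibleD(3)[OF h']
  have "linear_map B A (letter_value A (h + h'))"
    using linear_map_plus[OF bialgebraD(4)[OF A] L] by (simp add: lv(1)[abs_def])
  thus "admissible B A (h + h')"
    using admissibleD[OF h] admissibleD[OF h'] \<epsilon>
    by (simp add: admissible_def lv(1) dual_add A.scale_left_distrib algebra_simps)
  have app: "pointwise_smul r h w = r * h w" for w by (simp add: pointwise_smul_def)
  have "linear_map B A (letter_value A (pointwise_smul r h))"
    using L(1) by (simp add: linear_map_def lv(2) A.scale_right_distrib A.scale_left_commute)
  thus "admissible B A (pointwise_smul r h)"
    using admissibleD[OF h] \<epsilon>
    by (simp add: admissible_def lv(2) dual_scale app)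
qed

lemma splits_zero:
  assumes A: "bialgebra A"
  shows "splits B A 0 []"
  using linear_map_0[OF bialgebraD(4)[OF A] bialgebraD(5)[OF A]]
  by (simp add: splits_def letter_value_zero[OF A])

lemma splits_add:
  assumes A: "bialgebra A" and h: "admissible B A h" "splits B A h ps"
    and h': "admissible B A h'" "splits B A h' qs"
  shows "splits B A (h + h') (ps @ qs)"
  using assms(3,5) linear_mapD(2)[OF bialgebraD(5)[OF A]] bialgebraD(2)[OF A]
  by (simp add: splits_def letter_value_linear(1)[OF A h(1) h'(1)])

lemma letter_tens_bilinear:
  assumes A: "bialgebra A" and "admissible B A x" "admissible B A y"
  shows "bilinear_map B B (tensor_space A A) (\<lambda>b\<^sub>1 b\<^sub>2. tens A A (letter_value A x b\<^sub>1) (letter_value A y b\<^sub>2))"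
  using bilinear_map_comp[OF bilinear_map_tens[OF bialgebraD(4,4)[OF A]] assms(2,3)[THEN admissibleD(3)]] .

lemma splits_scale:
  fixes B :: "('k::field, 'b::ring_1) coalg" and A :: "('k, 'a::ring_1) coalg"
  assumes A: "bialgebra A" and B: "bialgebra B" and h: "admissible B A h" "splits B A h ps"
    and ps: "\<And>x y. (x, y) \<in> set ps \<Longrightarrow> admissible B A x \<and> admissible B A y"
  shows "splits B A (pointwise_smul r h) (map (\<lambda>(x, y). (pointwise_smul r x, y)) ps)"
proof -
  note VA = bialgebraD(4)[OF A] and VB = bialgebraD(4)[OF B]
  have [simp]: "carr A = UNIV" by (rule bialgebraD(2)[OF A])
  note lv = letter_value_linear(2)[OF A _ h(1)]
  let ?P = "map (\<lambda>(x, y). (pointwise_smul r x, y)) ps"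
  have "pointwise_smul r h (u @ v) = (\<Sum>(x, y)\<leftarrow>?P. x u * y v)" for u v
    using h(2)
    by (simp add: splits_def pointwise_smul_def case_prod_unfold o_def sum_list_const_mult mult.assoc)
  moreover have "letter_value A (pointwise_smul r h) (b * b') = (\<Sum>(x, y)\<leftarrow>?P. letter_value A x b * letter_value A y b')"
    for b b'
  proof -
    have "letter_value A (pointwise_smul r h) (b * b')
        = (\<Sum>p\<leftarrow>ps. smul A r (letter_value A (fst p) b * letter_value A (snd p) b'))"
      using h(2) by (simp add: lv[OF h(1)] splits_def case_prod_unfold smul_sum_list[OF is_vspaceD(1)[OF VA]])
    also have "\<dots> = (\<Sum>p\<leftarrow>ps. letter_value A (pointwise_smul r (fst p)) b * letter_value A (snd p) b')"
      using ps A by (intro arg_cong[of _ _ sum_list] map_cong refl) (auto simp: lv bialgebra_def)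
    finally show ?thesis by (simp add: case_prod_unfold o_def)
  qed
  moreover have "comult A (letter_value A (pointwise_smul r h) b) = (\<Sum>(x, y)\<leftarrow>?P.
      tensor_lift B B (\<lambda>b\<^sub>1 b\<^sub>2. tens A A (letter_value A x b\<^sub>1) (letter_value A y b\<^sub>2)) (comult B b))" for b
  proof -
    let ?t = "\<lambda>x y. tensor_lift B B (\<lambda>b\<^sub>1 b\<^sub>2. tens A A (letter_value A x b\<^sub>1) (letter_value A y b\<^sub>2)) (comult B b)"
    have AA: "smul (tensor_space A A) = pointwise_smul" by (simp add: tensor_space_def)
    have scale: "pointwise_smul r (?t x y) = ?t (pointwise_smul r x) y" if "(x, y) \<in> set ps" for x y
    proof -
      have xy: "admissible B A x" "admissible B A y" using ps that by blast+
      interpret T: vector_space "pointwise_smul :: 'k \<Rightarrow> ('k, 'a, 'a) tensor \<Rightarrow> _"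
        by (rule vector_space_pointwise)
      have "linear_map (tensor_space A A) (tensor_space A A) (pointwise_smul r)"
        using is_vspaceD(3)[OF is_vspace_tensor_space[of A A]]
        by (simp add: linear_map_def AA T.scale_right_distrib T.scale_left_commute)
      hence "pointwise_smul r (?t x y) = tensor_lift B B
          (\<lambda>b\<^sub>1 b\<^sub>2. pointwise_smul r (tens A A (letter_value A x b\<^sub>1) (letter_value A y b\<^sub>2))) (comult B b)"
        by (rule linear_map_tensor_lift[OF VB VB is_vspace_tensor_space is_vspace_tensor_space
              letter_tens_bilinear[OF A xy] _ bialgebraD(7)[OF B]])
      also have "\<dots> = ?t (pointwise_smul r x) y"
        using linear_mapD(3)[OF bilinear_mapD(2)[OF bilinear_map_tens[OF VA VA]]]
        by (intro tensor_lift_cong) (simp add: lv[OF xy(1)] AA)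
      finally show ?thesis .
    qed
    have "comult A (letter_value A (pointwise_smul r h) b) = pointwise_smul r (comult A (letter_value A h b))"
      using linear_mapD(3)[OF bialgebraD(5)[OF A]] by (simp add: lv[OF h(1)] AA)
    also have "\<dots> = (\<Sum>p\<leftarrow>ps. pointwise_smul r (?t (fst p) (snd p)))"
      using h(2) by (simp add: splits_def case_prod_unfold smul_sum_list[OF vector_space_pointwise])
    also have "\<dots> = (\<Sum>p\<leftarrow>ps. ?t (pointwise_smul r (fst p)) (snd p))"
      using scale by (intro arg_cong[of _ _ sum_list] map_cong refl) auto
    finally show ?thesis by (simp add: case_prod_unfold o_def)
  qed
  ultimately show ?thesis by (simp add: splits_def)
qed

lemma split_closed_universal_carrier: "split_closed B A (universal_carrier B A)"
  unfolding split_closed_def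
proof
  fix h assume "h \<in> universal_carrier B A"
  then obtain D where D: "split_closed B A D" "h \<in> D" by (auto simp: universal_carrier_def)
  hence "D \<subseteq> universal_carrier B A" by (auto simp: universal_carrier_def)
  thus "admissible B A h \<and>
      (\<exists>ps. set ps \<subseteq> universal_carrier B A \<times> universal_carrier B A \<and> splits B A h ps)"
    using D unfolding split_closed_def by (meson Sigma_mono order_trans)
qed

lemma universal_carrierD:
  assumes "h \<in> universal_carrier B A"
  shows "admissible B A h"
    and "\<exists>ps. set ps \<subseteq> universal_carrier B A \<times> universal_carrier B A \<and> splits B A h ps"
  using split_closed_universal_carrier[of B A] assms by (auto simp: split_closed_def)

lemma split_closed_subset: "split_closed B A D \<Longrightarrow> D \<subseteq> universal_carrier B A"
  by (auto simp: universal_carrier_def)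

text \<open>
  The sums and the scalar multiples of elements of the greatest split-closed set form split-closed
  sets again, and so are contained in it.
\<close>

lemma universal_carrier_subspace:
  fixes B :: "('k::field, 'b::ring_1) coalg" and A :: "('k, 'a::ring_1) coalg"
  assumes A: "bialgebra A" and B: "bialgebra B"
  shows "0 \<in> universal_carrier B A"
    and "h \<in> universal_carrier B A \<Longrightarrow> h' \<in> universal_carrier B A \<Longrightarrow> h + h' \<in> universal_carrier B A"
    and "h \<in> universal_carrier B A \<Longrightarrow> pointwise_smul r h \<in> universal_carrier B A"
proof -
  let ?U = "universal_carrier B A"
  interpret W: vector_space "pointwise_smul :: 'k \<Rightarrow> ('k, 'b, 'a) words \<Rightarrow> _"
    by (rule vector_space_pointwise)
  have "split_closed B A {0}"
    using admissible_zero[OF A] splits_zero[OF A] by (auto simp: split_closed_def intro!: exI[of _ "[]"])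
  thus 0: "0 \<in> ?U" using split_closed_subset by blast
  let ?S = "{x + y | x y. x \<in> ?U \<and> y \<in> ?U}"
  have "split_closed B A ?S"
    unfolding split_closed_def
  proof
    fix h assume "h \<in> ?S"
    then obtain x y where h: "h = x + y" and x: "x \<in> ?U" and y: "y \<in> ?U" by blast
    obtain ps qs where ps: "set ps \<subseteq> ?U \<times> ?U" "splits B A x ps"
      and qs: "set qs \<subseteq> ?U \<times> ?U" "splits B A y qs"
      using universal_carrierD(2) x y by metis
    \<comment> \<open>Taking one summand to be \<open>0\<close> shows that the splittings of both summands stay inside the set of sums.\<close>
    have "?U \<subseteq> ?S" using 0 by (force intro: exI[of _ "0 :: ('k, 'b, 'a) words"])
    hence "set (ps @ qs) \<subseteq> ?S \<times> ?S" using ps(1) qs(1) by auto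
    moreover have "splits B A h (ps @ qs)"
      unfolding h using splits_add[OF A _ ps(2) _ qs(2)] universal_carrierD(1) x y by blast
    moreover have "admissible B A h"
      unfolding h using admissible_closed(1)[OF A] universal_carrierD(1) x y by blast
    ultimately show "admissible B A h \<and> (\<exists>ps. set ps \<subseteq> ?S \<times> ?S \<and> splits B A h ps)" by blast
  qed
  thus "h + h' \<in> ?U" if "h \<in> ?U" "h' \<in> ?U" using split_closed_subset that by blast
  let ?R = "{pointwise_smul r x | r x. x \<in> ?U}"
  have "split_closed B A ?R"
    unfolding split_closed_def
  proof
    fix h assume "h \<in> ?R"
    then obtain r x where h: "h = pointwise_smul r x" and x: "x \<in> ?U" by blast
    obtain ps where ps: "set ps \<subseteq> ?U \<times> ?U" "splits B A x ps"
      using universal_carrierD(2) x by metis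
    have "?U \<subseteq> ?R" by (force intro: exI[of _ "1 :: 'k"] simp: W.scale_one)
    hence "set (map (\<lambda>(x, y). (pointwise_smul r x, y)) ps) \<subseteq> ?R \<times> ?R" using ps(1) by auto
    moreover have "splits B A h (map (\<lambda>(x, y). (pointwise_smul r x, y)) ps)"
      unfolding h using universal_carrierD(1) x ps(1) by (intro splits_scale[OF A B _ ps(2)]) auto
    moreover have "admissible B A h"
      unfolding h using admissible_closed(2)[OF A] universal_carrierD(1) x by blast
    ultimately show "admissible B A h \<and> (\<exists>ps. set ps \<subseteq> ?R \<times> ?R \<and> splits B A h ps)" by blast
  qed
  thus "pointwise_smul r h \<in> ?U" if "h \<in> ?U" using split_closed_subset that by blast
qed

lemma representative_coalgebra_sel [simp]:
  "carr (representative_coalgebra B A) = universal_carrier B A"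
  "smul (representative_coalgebra B A) = pointwise_smul"
  "counit (representative_coalgebra B A) h = h []"
  by (simp_all add: representative_coalgebra_def Let_def)

lemma is_vspace_representative:
  fixes B :: "('k::field, 'b::ring_1) coalg" and A :: "('k, 'a::ring_1) coalg"
  assumes "bialgebra A" "bialgebra B"
  shows "is_vspace (representative_coalgebra B A)"
proof -
  interpret vector_space "pointwise_smul :: 'k \<Rightarrow> ('k, 'b, 'a) words \<Rightarrow> _"
    by (rule vector_space_pointwise)
  show ?thesis
    using universal_carrier_subspace[OF assms] vector_space_pointwise
    by (simp add: is_vspace_def subspace_def)
qed

lemma representative_comult:
  assumes "bialgebra A" "bialgebra B" "h \<in> universal_carrier B A"
  obtains ps where
    "represents (representative_coalgebra B A) (representative_coalgebra B A)
       (comult (representative_coalgebra B A) h) ps"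
    "splits B A h ps"
proof -
  let ?U = "universal_carrier B A" and ?R = "representative_coalgebra B A"
  define ps where "ps = (SOME ps. set ps \<subseteq> ?U \<times> ?U \<and> splits B A h ps)"
  have ps: "set ps \<subseteq> ?U \<times> ?U" "splits B A h ps"
    using someI_ex[OF universal_carrierD(2)[OF assms(3)]] unfolding ps_def by blast+
  let ?V = "\<lparr>carr = ?U, smul = pointwise_smul\<rparr>"
  have "tens ?V ?V = tens ?R ?R" by (intro tens_eqI) simp_all
  hence "comult ?R h = (\<Sum>(x, y)\<leftarrow>ps. tens ?R ?R x y)"
    by (simp add: ps_def representative_coalgebra_def Let_def)
  thus ?thesis using ps that by (simp add: represents_def)
qed

definition word_value :: "('b \<times> ('a \<Rightarrow> 'k)) list \<Rightarrow> ('k, 'b, 'a) words \<Rightarrow> 'k" where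
  "word_value w h = h w"

lemma word_value_dual:
  "word_value w \<in> dual (representative_coalgebra B A)"
  by (simp add: dual_def linear_map_def base_field_def word_value_def pointwise_smul_def)

lemma separating_word_values:
  "separating (representative_coalgebra B A) (range word_value)"
  using word_value_dual by (auto simp: separating_def word_value_def)

lemma pairing_word_values_comult:
  assumes "bialgebra A" "bialgebra B" "h \<in> universal_carrier B A"
  shows "pairing (representative_coalgebra B A) (representative_coalgebra B A)
      (word_value u) (word_value v) (comult (representative_coalgebra B A) h) = h (u @ v)"
proof -
  let ?R = "representative_coalgebra B A"
  note V = is_vspace_representative[OF assms(1,2)]
  obtain ps where ps: "represents ?R ?R (comult ?R h) ps" "splits B A h ps"
    using representative_comult[OF assms] .
  show ?thesis
    using pairing_represents[OF V V word_value_dual word_value_dual ps(1), of u v] ps(2)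
    by (simp add: splits_def word_value_def)
qed

lemma comult_in_representative:
  assumes "bialgebra A" "bialgebra B" "h \<in> universal_carrier B A"
  shows "comult (representative_coalgebra B A) h
    \<in> carr (tensor_space (representative_coalgebra B A) (representative_coalgebra B A))"
  using representative_comult[OF assms] represents_in_tensor_space is_vspace_representative[OF assms(1,2)]
  by metis

text \<open>
  Although the comultiplication was defined by an arbitrary choice of splittings, it is
  determined by the values of \<open>h\<close>, because evaluations at pairs of words separate the
  points of the tensor square. Its linearity and its compatibility with the
  representation of a covering follow from this.
\<close>

lemma representative_comult_unique:
  assumes "bialgebra A" "bialgebra B" "h \<in> universal_carrier B A"
    "t \<in> carr (tensor_space (representative_coalgebra B A) (representative_coalgebra B A))"
    "\<And>u v. pairing (representative_coalgebra B A) (representative_coalgebra B A)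
      (word_value u) (word_value v) t = h (u @ v)"
  shows "comult (representative_coalgebra B A) h = t"
proof -
  note V = is_vspace_representative[OF assms(1,2)]
  show ?thesis
    by (rule separatingD[OF separating_pairing[OF V V separating_word_values separating_word_values]
          comult_in_representative[OF assms(1-3)] assms(4)])
      (auto simp: pairing_word_values_comult[OF assms(1-3)] assms(5))
qed

lemma representative_comult_linear:
  assumes A: "bialgebra A" and B: "bialgebra B"
  shows "linear_map (representative_coalgebra B A)
    (tensor_space (representative_coalgebra B A) (representative_coalgebra B A))
    (comult (representative_coalgebra B A))"
proof -
  let ?R = "representative_coalgebra B A"
  note V = is_vspace_representative[OF A B]
  note T = is_vspace_tensor_space[of ?R ?R]
  note \<Delta> = comult_in_representative[OF A B]
  note P = pairing_dual[OF V V word_value_dual word_value_dual]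
  note val = pairing_word_values_comult[OF A B]
  note sub = universal_carrier_subspace[OF A B]
  have "comult ?R (h + h') = comult ?R h + comult ?R h'"
    if "h \<in> universal_carrier B A" "h' \<in> universal_carrier B A" for h h'
    using that dual_add[OF P \<Delta> \<Delta>] val is_vspaceD(4)[OF T \<Delta> \<Delta>]
    by (intro representative_comult_unique[OF A B sub(2)]) auto
  moreover have "comult ?R (pointwise_smul r h) = smul (tensor_space ?R ?R) r (comult ?R h)"
    if "h \<in> universal_carrier B A" for r h
    using that dual_scale[OF P \<Delta>] val is_vspaceD(3)[OF T \<Delta>]
    by (intro representative_comult_unique[OF A B sub(3)]) (auto simp: pointwise_smul_def[of r h])
  ultimately show ?thesis using \<Delta> by (simp add: linear_map_def)
qed

lemma conv_word_values:
  assumes "bialgebra A" "bialgebra B" "h \<in> universal_carrier B A"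
  shows "conv (representative_coalgebra B A) (word_value u) (word_value v) h = word_value (u @ v) h"
  using pairing_word_values_comult[OF assms] by (simp add: conv_def word_value_def)

text \<open>
  Coassociativity is associativity of concatenation: tested against evaluations at three words
  \<open>u\<close>, \<open>v\<close>, \<open>w\<close>, both triple coproducts of \<open>h\<close> give the value of \<open>h\<close> at \<open>u @ v @ w\<close>. In the same way, the
  counit axioms say that the empty word is neutral.
\<close>

lemma coalgebra_representative:
  assumes A: "bialgebra A" and B: "bialgebra B"
  shows "coalgebra (representative_coalgebra B A)"
proof -
  let ?R = "representative_coalgebra B A"
  note V = is_vspace_representative[OF A B]
  note T = is_vspace_tensor_space[of ?R ?R]
  note \<Delta> = representative_comult_linear[OF A B]
  note W = word_value_dual
  have id: "linear_map ?R ?R id" using linear_map_ident by (simp add: id_def)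
  have coassoc: "tensor_assoc ?R ?R ?R (tensor_map ?R ?R (tensor_space ?R ?R) ?R (comult ?R) id (comult ?R h)) =
        tensor_map ?R ?R ?R (tensor_space ?R ?R) id (comult ?R) (comult ?R h)"
    if h: "h \<in> universal_carrier B A" for h
  proof (rule separatingD[OF separating_pairing[OF V T separating_word_values
            separating_pairing[OF V V separating_word_values separating_word_values]]])
    have t: "comult ?R h \<in> carr (tensor_space ?R ?R)" by (rule comult_in_representative[OF A B h])
    show "tensor_assoc ?R ?R ?R (tensor_map ?R ?R (tensor_space ?R ?R) ?R (comult ?R) id (comult ?R h))
        \<in> carr (tensor_space ?R (tensor_space ?R ?R))"
      by (intro linear_mapD(1)[OF tensor_assoc_linear[OF V V V]]
          linear_mapD(1)[OF tensor_map_linear[OF V V T V \<Delta> id] t])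
    show "tensor_map ?R ?R ?R (tensor_space ?R ?R) id (comult ?R) (comult ?R h)
        \<in> carr (tensor_space ?R (tensor_space ?R ?R))"
      by (rule linear_mapD(1)[OF tensor_map_linear[OF V V V T id \<Delta>] t])
    fix \<omega>
    assume "\<omega> \<in> {pairing ?R (tensor_space ?R ?R) \<phi> \<psi> | \<phi> \<psi>. \<phi> \<in> range word_value \<and>
      \<psi> \<in> {pairing ?R ?R \<phi> \<psi> | \<phi> \<psi>. \<phi> \<in> range word_value \<and> \<psi> \<in> range word_value}}"
    then obtain u v w where \<omega>: "\<omega> = pairing ?R (tensor_space ?R ?R) (word_value u)
        (pairing ?R ?R (word_value v) (word_value w))" by blast
    have h': "h \<in> carr ?R" using h by simp
    have "conv ?R (conv ?R (word_value u) (word_value v)) (word_value w) h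
        = conv ?R (word_value (u @ v)) (word_value w) h"
      using conv_word_values[OF A B] by (intro conv_cong) auto
    also have "\<dots> = conv ?R (word_value u) (word_value (v @ w)) h"
      by (simp add: conv_word_values[OF A B h])
    also have "\<dots> = conv ?R (word_value u) (conv ?R (word_value v) (word_value w)) h"
      using conv_word_values[OF A B] by (intro conv_cong) auto
    finally show "\<omega> (tensor_assoc ?R ?R ?R (tensor_map ?R ?R (tensor_space ?R ?R) ?R (comult ?R) id (comult ?R h)))
        = \<omega> (tensor_map ?R ?R ?R (tensor_space ?R ?R) id (comult ?R) (comult ?R h))"
      by (simp only: \<omega> conv_conv[OF V \<Delta> W W W h'])
  qed
  have \<epsilon>: "linear_map ?R base_field (counit ?R)"
    by (simp add: linear_map_def base_field_def pointwise_smul_def)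
  have \<beta>: "bilinear_map ?R ?R ?R (\<lambda>x y. smul ?R (counit ?R x) y)"
    "bilinear_map ?R ?R ?R (\<lambda>x y. smul ?R (counit ?R y) x)"
    using bilinear_map_comp[OF bilinear_map_smul[OF V] \<epsilon> linear_map_ident]
    by (auto simp only: bilinear_map_def)
  have counits: "tensor_lift ?R ?R (\<lambda>x y. smul ?R (counit ?R x) y) (comult ?R h) = h"
      "tensor_lift ?R ?R (\<lambda>x y. smul ?R (counit ?R y) x) (comult ?R h) = h"
    if h: "h \<in> universal_carrier B A" for h
  proof -
    obtain ps where ps: "represents ?R ?R (comult ?R h) ps" "splits B A h ps"
      using representative_comult[OF A B h] .
    have "h w = (\<Sum>(x, y)\<leftarrow>ps. x [] * y w)" "h w = (\<Sum>(x, y)\<leftarrow>ps. x w * y [])" for w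
      using ps(2) unfolding splits_def by (metis append_Nil, metis append_Nil2)
    thus "tensor_lift ?R ?R (\<lambda>x y. smul ?R (counit ?R x) y) (comult ?R h) = h"
      "tensor_lift ?R ?R (\<lambda>x y. smul ?R (counit ?R y) x) (comult ?R h) = h"
      unfolding tensor_lift_represents[OF V V V \<beta>(1) ps(1)] tensor_lift_represents[OF V V V \<beta>(2) ps(1)]
      by (auto simp: fun_eq_iff sum_list_fun_apply case_prod_unfold pointwise_smul_def mult.commute)
  qed
  show ?thesis
    using V \<Delta> \<epsilon> coassoc counits unfolding coalgebra_def by simp
qed

lemma covering_form_letter_value:
  assumes A: "bialgebra A" and B: "bialgebra B"
  shows "covering_form B (representative_coalgebra B A) A (\<lambda>b h. letter_value A h b)"
proof -
  let ?R = "representative_coalgebra B A"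
  note V = is_vspace_representative[OF A B] and VA = bialgebraD(4)[OF A] and VB = bialgebraD(4)[OF B]
  note adm = universal_carrierD(1)[of _ B A]
  have lin: "linear_map ?R A (\<lambda>h. letter_value A h b)" for b
    using letter_value_linear[OF A adm adm] by (simp add: linear_map_def bialgebraD(2)[OF A])
  have \<beta>: "bilinear_map B ?R A (\<lambda>b h. letter_value A h b)"
    using admissibleD(3)[OF adm] lin by (intro bilinear_mapI) auto
  have "letter_value A h (b * b')
      = tensor_lift ?R ?R (\<lambda>x y. letter_value A x b * letter_value A y b') (comult ?R h)"
    "comult A (letter_value A h b) = tensor_lift B B (\<lambda>b\<^sub>1 b\<^sub>2. tensor_lift ?R ?R
        (\<lambda>x y. tens A A (letter_value A x b\<^sub>1) (letter_value A y b\<^sub>2)) (comult ?R h)) (comult B b)"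
    if h: "h \<in> universal_carrier B A" for h b b'
  proof -
    obtain ps where ps: "represents ?R ?R (comult ?R h) ps" "splits B A h ps"
      using representative_comult[OF A B h] .
    have "bilinear_map ?R ?R A (\<lambda>x y. letter_value A x b * letter_value A y b')"
      by (rule bilinear_map_comp[OF bialgebraD(3)[OF A] lin lin])
    thus "letter_value A h (b * b')
        = tensor_lift ?R ?R (\<lambda>x y. letter_value A x b * letter_value A y b') (comult ?R h)"
      using tensor_lift_represents[OF V V VA _ ps(1)] ps(2) by (simp add: splits_def)
    have "bilinear_map ?R ?R (tensor_space A A) (\<lambda>x y. tens A A (letter_value A x b\<^sub>1) (letter_value A y b\<^sub>2))" for b\<^sub>1 b\<^sub>2
      by (rule bilinear_map_comp[OF bilinear_map_tens[OF VA VA] lin lin])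
    note inner = tensor_lift_represents[OF V V is_vspace_tensor_space this ps(1)]
    have Q: "bilinear_map B B (tensor_space A A)
        (\<lambda>b\<^sub>1 b\<^sub>2. tens A A (letter_value A (fst p) b\<^sub>1) (letter_value A (snd p) b\<^sub>2))"
      if "p \<in> set ps" for p
      using that representsD[OF ps(1), of "fst p" "snd p"]
      by (intro letter_tens_bilinear[OF A] adm) auto
    have "comult A (letter_value A h b) = (\<Sum>p\<leftarrow>ps. tensor_lift B B
        (\<lambda>b\<^sub>1 b\<^sub>2. tens A A (letter_value A (fst p) b\<^sub>1) (letter_value A (snd p) b\<^sub>2)) (comult B b))"
      using ps(2) by (simp add: splits_def case_prod_unfold)
    also have "\<dots> = tensor_lift B B (\<lambda>b\<^sub>1 b\<^sub>2. \<Sum>p\<leftarrow>ps.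
        tens A A (letter_value A (fst p) b\<^sub>1) (letter_value A (snd p) b\<^sub>2)) (comult B b)"
      by (rule tensor_lift_list_sum[OF VB VB is_vspace_tensor_space Q bialgebraD(7)[OF B], symmetric])
    finally show "comult A (letter_value A h b) = tensor_lift B B (\<lambda>b\<^sub>1 b\<^sub>2. tensor_lift ?R ?R
        (\<lambda>x y. tens A A (letter_value A x b\<^sub>1) (letter_value A y b\<^sub>2)) (comult ?R h)) (comult B b)"
      by (simp only: inner case_prod_unfold)
  qed
  thus ?thesis
    using \<beta> admissibleD(4,5)[OF adm] by (simp add: covering_form_def)
qed

lemma partial_covering_representative:
  assumes A: "bialgebra A" and B: "bialgebra B"
  shows "partial_covering B (representative_coalgebra B A) A (representative_covering B A)"
    and "h \<in> universal_carrier B A \<Longrightarrow>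
      representative_covering B A (tens B (representative_coalgebra B A) b h) = letter_value A h b"
proof -
  let ?R = "representative_coalgebra B A"
  note V = is_vspace_representative[OF A B] and VA = bialgebraD(4)[OF A] and VB = bialgebraD(4)[OF B]
  note g = covering_form_letter_value[OF A B]
  have \<beta>: "bilinear_map B ?R A (\<lambda>b h. letter_value A h b)"
    using g by (simp add: covering_form_def)
  show val: "representative_covering B A (tens B ?R b h) = letter_value A h b"
    if "h \<in> universal_carrier B A" for b h
    unfolding representative_covering_def
    by (rule tensor_universal(2)[OF VB V VA \<beta>]) (use that bialgebraD(2)[OF B] in auto)
  have "covering_form B ?R A (\<lambda>b h. representative_covering B A (tens B ?R b h))"
  proof -
    have eq: "tensor_lift ?R ?R (\<lambda>x y. representative_covering B A (tens B ?R b x) *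
          representative_covering B A (tens B ?R b' y)) t
        = tensor_lift ?R ?R (\<lambda>x y. letter_value A x b * letter_value A y b') t"
      "tensor_lift ?R ?R (\<lambda>x y. tens A A (representative_covering B A (tens B ?R b x))
          (representative_covering B A (tens B ?R b' y))) t
        = tensor_lift ?R ?R (\<lambda>x y. tens A A (letter_value A x b) (letter_value A y b')) t" for b b' t
      by (intro tensor_lift_cong; simp add: val)+
    have "bilinear_map B ?R A (\<lambda>b h. representative_covering B A (tens B ?R b h))"
      using \<beta> by (subst bilinear_map_cong[OF VB V, where \<gamma> = "\<lambda>b h. letter_value A h b"]) (simp_all add: val)
    with g show ?thesis by (simp add: covering_form_def eq val)
  qed
  moreover have "linear_map (tensor_space B ?R) A (representative_covering B A)"
    unfolding representative_covering_def by (rule tensor_universal(1)[OF VB V VA \<beta>])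
  ultimately show "partial_covering B ?R A (representative_covering B A)"
    using partial_covering_iff[OF A B coalgebra_representative[OF A B]] by blast
qed


section \<open>The representation of a partial covering by functions on words\<close>

text \<open>
  The default value \<open>0\<close> is the one that \<open>admissible\<close> demands on letters without a linear functional.
\<close>

definition letter_functional ::
  "('k::field, 'a::ring_1) coalg \<Rightarrow> ('b \<Rightarrow> 'c \<Rightarrow> 'a) \<Rightarrow> 'b \<times> ('a \<Rightarrow> 'k) \<Rightarrow> 'c \<Rightarrow> 'k" where
  "letter_functional A g l c = (if snd l \<in> dual A then snd l (g (fst l) c) else 0)"

text \<open>
  The convolution product of the functionals of the letters,
  \<open>c \<mapsto> \<Sum> \<phi>\<^sub>1 (f (b\<^sub>1 \<otimes> c\<^sub>1)) * \<dots> * \<phi>\<^sub>n (f (b\<^sub>n \<otimes> c\<^sub>n))\<close>. Thus words are mapped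
  multiplicatively to the convolution algebra, and the transposed map sends \<open>C\<close> to functions on words.
\<close>

primrec word_functional ::
  "('k::field, 'c::ab_group_add) coalg \<Rightarrow> ('k, 'a::ring_1) coalg \<Rightarrow> ('b \<Rightarrow> 'c \<Rightarrow> 'a)
    \<Rightarrow> ('b \<times> ('a \<Rightarrow> 'k)) list \<Rightarrow> 'c \<Rightarrow> 'k" where
  "word_functional C A g [] = counit C"
| "word_functional C A g (l # w) = conv C (letter_functional A g l) (word_functional C A g w)"

definition to_words ::
  "('k::field, 'c::ab_group_add) coalg \<Rightarrow> ('k, 'a::ring_1) coalg \<Rightarrow> ('b \<Rightarrow> 'c \<Rightarrow> 'a)
    \<Rightarrow> 'c \<Rightarrow> ('k, 'b, 'a) words" where
  "to_words C A g c = (\<lambda>w. word_functional C A g w c)"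

lemma letter_functional_dual:
  assumes "bilinear_map B C A g" "carr B = UNIV"
  shows "letter_functional A g l \<in> dual C"
proof (cases "snd l \<in> dual A")
  case True
  have "linear_map C A (g (fst l))" using bilinear_mapD(1)[OF assms(1)] assms(2) by simp
  from dual_comp[OF this True] True show ?thesis by (simp add: letter_functional_def[abs_def])
next
  case False
  hence "letter_functional A g l = (\<lambda>c. 0)" by (simp add: letter_functional_def fun_eq_iff)
  thus ?thesis by (simp add: dual_def linear_map_def base_field_def)
qed

lemma word_functional_dual:
  assumes "coalgebra C" "bilinear_map B C A g" "carr B = UNIV"
  shows "word_functional C A g w \<in> dual C"
  using coalgebraD(1-3)[OF assms(1)]
  by (induction w) (simp_all add: conv_dual letter_functional_dual[OF assms(2,3)])

lemma word_functional_append: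
  assumes C: "coalgebra C" and g: "bilinear_map B C A g" and B: "carr B = UNIV" and c: "c \<in> carr C"
  shows "word_functional C A g (u @ v) c = conv C (word_functional C A g u) (word_functional C A g v) c"
  using c
proof (induction u arbitrary: c)
  case Nil
  thus ?case using conv_counit_left[OF C word_functional_dual[OF C g B]] by simp
next
  case (Cons l u)
  have "word_functional C A g ((l # u) @ v) c = conv C (letter_functional A g l)
      (conv C (word_functional C A g u) (word_functional C A g v)) c"
    using Cons.IH by (auto intro: conv_cong)
  also have "\<dots> = conv C (word_functional C A g (l # u)) (word_functional C A g v) c"
    using conv_assoc[OF C letter_functional_dual[OF g B] word_functional_dual[OF C g B]
        word_functional_dual[OF C g B] Cons.prems] by simp
  finally show ?case .
qed

lemma to_words_letter:
  assumes A: "bialgebra A" and C: "coalgebra C" and g: "bilinear_map B C A g" and B: "carr B = UNIV"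
    and c: "c \<in> carr C"
  shows "to_words C A g c [l] = letter_functional A g l c"
    and "letter_value A (to_words C A g c) b = g b c"
proof -
  show *: "to_words C A g c [l] = letter_functional A g l c" for l
    using conv_counit_right[OF C letter_functional_dual[OF g B] c] by (simp add: to_words_def)
  show "letter_value A (to_words C A g c) b = g b c"
    using * by (intro letter_value_eqI[OF A]) (simp add: letter_functional_def)
qed

lemma to_words_linear:
  assumes "bialgebra A" "coalgebra C" "bilinear_map B C A g" "carr B = UNIV"
    and "\<And>c. c \<in> carr C \<Longrightarrow> to_words C A g c \<in> universal_carrier B A"
  shows "linear_map C (representative_coalgebra B A) (to_words C A g)"
  using assms(5)
  by (auto simp: linear_map_def to_words_def fun_eq_iff pointwise_smul_def
      dual_add[OF word_functional_dual[OF assms(2-4)]] dual_scale[OF word_functional_dual[OF assms(2-4)]])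

text \<open>
  The image of \<open>C\<close> is split-closed: if \<open>ps\<close> represents \<open>\<Delta> c\<close>, then its image under the
  representation splits the function of \<open>c\<close>, by multiplicativity and the axioms of a covering.
\<close>

lemma to_words_in_universal_carrier:
  assumes A: "bialgebra A" and B: "bialgebra B" and C: "coalgebra C" and g: "covering_form B C A g"
    and c: "c \<in> carr C"
  shows "to_words C A g c \<in> universal_carrier B A"
proof -
  note VA = bialgebraD(4)[OF A] and VB = bialgebraD(4)[OF B] and VC = coalgebraD(1)[OF C]
  note UB = bialgebraD(2)[OF B]
  have \<beta>: "bilinear_map B C A g" using g by (simp add: covering_form_def)
  have "split_closed B A (to_words C A g ` carr C)"
    unfolding split_closed_def
  proof (clarify, intro conjI)
    fix c assume c: "c \<in> carr C"
    have lv: "letter_value A (to_words C A g x) = (\<lambda>b. g b x)" if "x \<in> carr C" for x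
      using to_words_letter(2)[OF A C \<beta> UB that] by blast
    show "admissible B A (to_words C A g c)"
      unfolding admissible_def lv[OF c]
    proof (intro conjI allI)
      show "to_words C A g c [(b, \<phi>)] = (if \<phi> \<in> dual A then \<phi> (g b c) else 0)" for b \<phi>
        using to_words_letter(1)[OF A C \<beta> UB c] by (simp add: letter_functional_def)
      show "linear_map B A (\<lambda>b. g b c)" using bilinear_mapD(2)[OF \<beta> c] .
      show "g 1 c = smul A (to_words C A g c []) 1"
        "counit A (g b c) = counit B b * to_words C A g c []" for b
        using covering_formD(2,4)[OF g c] by (simp_all add: to_words_def)
    qed
    obtain ps where ps: "represents C C (comult C c) ps"
      using represents_exists[OF VC VC coalgebraD(5)[OF C c]] .
    \<comment> \<open>The splitting of the function of \<open>c\<close> is the image of the Sweedler sum of \<open>\<Delta> c\<close>.\<close>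
    let ?ps = "map (\<lambda>(x, y). (to_words C A g x, to_words C A g y)) ps"
    have lv': "letter_value A (to_words C A g (fst p)) = (\<lambda>b. g b (fst p))"
      "letter_value A (to_words C A g (snd p)) = (\<lambda>b. g b (snd p))" if "p \<in> set ps" for p
      using lv representsD[OF ps] that by (cases p; simp)+
    have "set ?ps \<subseteq> to_words C A g ` carr C \<times> to_words C A g ` carr C"
      using representsD[OF ps] by auto
    moreover have "splits B A (to_words C A g c) ?ps"
      unfolding splits_def lv[OF c]
    proof (intro conjI allI)
      fix u v
      show "to_words C A g c (u @ v) = (\<Sum>(x, y)\<leftarrow>?ps. x u * y v)"
        using word_functional_append[OF C \<beta> UB c]
          pairing_represents[OF VC VC word_functional_dual[OF C \<beta> UB] word_functional_dual[OF C \<beta> UB] ps]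
        by (simp add: to_words_def conv_def case_prod_unfold o_def)
    next
      fix b b'
      have "bilinear_map C C A (\<lambda>x y. g b x * g b' y)"
        using bilinear_map_comp[OF bialgebraD(3)[OF A] bilinear_mapD(1)[OF \<beta>] bilinear_mapD(1)[OF \<beta>]] UB by simp
      from tensor_lift_represents[OF VC VC VA this ps]
      show "g (b * b') c = (\<Sum>(x, y)\<leftarrow>?ps. letter_value A x b * letter_value A y b')"
        using covering_formD(1)[OF g c] lv' by (simp add: case_prod_unfold o_def cong: map_cong)
    next
      fix b
      note Q = covering_form_quadrilinear[OF VB VC VA \<beta>]
      have Q': "bilinear_map B B (tensor_space A A) (\<lambda>b\<^sub>1 b\<^sub>2. tens A A (g b\<^sub>1 (fst p)) (g b\<^sub>2 (snd p)))"
        if "p \<in> set ps" for p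
        using that representsD[OF ps, of "fst p" "snd p"] by (intro Q(2)) auto
      have "comult A (g b c) = tensor_lift B B (\<lambda>b\<^sub>1 b\<^sub>2. \<Sum>p\<leftarrow>ps. tens A A (g b\<^sub>1 (fst p)) (g b\<^sub>2 (snd p))) (comult B b)"
        using tensor_lift_represents[OF VC VC is_vspace_tensor_space Q(1) ps] UB covering_formD(3)[OF g c]
        by (simp add: case_prod_unfold)
      also have "\<dots> = (\<Sum>p\<leftarrow>ps. tensor_lift B B (\<lambda>b\<^sub>1 b\<^sub>2. tens A A (g b\<^sub>1 (fst p)) (g b\<^sub>2 (snd p))) (comult B b))"
        by (rule tensor_lift_list_sum[OF VB VB is_vspace_tensor_space Q' bialgebraD(7)[OF B]])
      finally show "comult A (g b c) = (\<Sum>(x, y)\<leftarrow>?ps.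
          tensor_lift B B (\<lambda>b\<^sub>1 b\<^sub>2. tens A A (letter_value A x b\<^sub>1) (letter_value A y b\<^sub>2)) (comult B b))"
        using lv' by (simp add: case_prod_unfold o_def cong: map_cong)
    qed
    ultimately show "\<exists>ps. set ps \<subseteq> to_words C A g ` carr C \<times> to_words C A g ` carr C \<and>
        splits B A (to_words C A g c) ps" by blast
  qed
  thus ?thesis using split_closed_subset c by blast
qed

lemma to_words_coalgebra_map:
  assumes A: "bialgebra A" and B: "bialgebra B" and C: "coalgebra C" and g: "covering_form B C A g"
  shows "coalgebra_map C (representative_coalgebra B A) (to_words C A g)"
proof -
  let ?R = "representative_coalgebra B A" and ?F = "to_words C A g"
  note V = is_vspace_representative[OF A B] and VC = coalgebraD(1)[OF C]
  note UB = bialgebraD(2)[OF B]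
  have \<beta>: "bilinear_map B C A g" using g by (simp add: covering_form_def)
  note mem = to_words_in_universal_carrier[OF A B C g]
  note L = to_words_linear[OF A C \<beta> UB mem]
  have wv: "(\<lambda>c. word_value u (?F c)) = word_functional C A g u" for u
    by (simp add: word_value_def to_words_def)
  have "comult ?R (?F c) = tensor_map C C ?R ?R ?F ?F (comult C c)" if c: "c \<in> carr C" for c
  proof (rule representative_comult_unique[OF A B mem[OF c]])
    note \<Delta>c = coalgebraD(5)[OF C c]
    show "tensor_map C C ?R ?R ?F ?F (comult C c) \<in> carr (tensor_space ?R ?R)"
      by (rule linear_mapD(1)[OF tensor_map_linear[OF VC VC V V L L] \<Delta>c])
    show "pairing ?R ?R (word_value u) (word_value v) (tensor_map C C ?R ?R ?F ?F (comult C c)) = ?F c (u @ v)"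
      for u v
      using pairing_tensor_map[OF VC VC V V L L word_value_dual word_value_dual \<Delta>c]
        word_functional_append[OF C \<beta> UB c]
      by (simp add: wv conv_def) (simp add: to_words_def conv_def)
  qed
  thus ?thesis using L by (simp add: coalgebra_map_def) (simp add: to_words_def)
qed

text \<open>
  A coalgebra map into functions on words is determined by its values on the empty word and on letters:
  since it preserves comultiplication, its value at a word \<open>l # w\<close> is the convolution
  product of those at \<open>l\<close> and \<open>w\<close>. The counit prescribes the value on
  the empty word, and the covering those on letters.
\<close>

lemma to_words_unique:
  assumes A: "bialgebra A" and B: "bialgebra B" and C: "coalgebra C" and g: "covering_form B C A g"
    and F: "coalgebra_map C (representative_coalgebra B A) F"
    and fac: "\<And>b c. c \<in> carr C \<Longrightarrow> g b c = letter_value A (F c) b"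
    and c: "c \<in> carr C"
  shows "F c = to_words C A g c"
proof -
  let ?R = "representative_coalgebra B A"
  have \<beta>: "bilinear_map B C A g" using g by (simp add: covering_form_def)
  have mem: "F c \<in> universal_carrier B A" if "c \<in> carr C" for c
    using linear_mapD(1)[OF coalgebra_mapD(1)[OF F] that] by simp
  have letter: "word_value [l] (F c) = letter_functional A g l c" if "c \<in> carr C" for c l
    using admissibleD(1,2)[OF universal_carrierD(1)[OF mem[OF that]]] fac[OF that]
    by (cases l) (auto simp: word_value_def letter_functional_def)
  have "word_value w (F c) = word_functional C A g w c" for w
    using c
  proof (induction w arbitrary: c)
    case Nil
    thus ?case using coalgebra_mapD(3)[OF F] by (simp add: word_value_def)
  next
    case (Cons l w)
    have "word_value ([l] @ w) (F c) = conv ?R (word_value [l]) (word_value w) (F c)"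
      by (rule conv_word_values[OF A B mem[OF Cons.prems], symmetric])
    also have "\<dots> = conv C (\<lambda>c. word_value [l] (F c)) (\<lambda>c. word_value w (F c)) c"
      by (rule conv_coalgebra_map[OF C coalgebra_representative[OF A B] F word_value_dual word_value_dual Cons.prems])
    also have "\<dots> = conv C (letter_functional A g l) (word_functional C A g w) c"
      using Cons.IH letter by (intro conv_cong) auto
    finally show ?case by simp
  qed
  thus ?thesis by (simp add: fun_eq_iff word_value_def to_words_def)
qed


section \<open>Universality\<close>

text \<open>
  Testing the factorization on pure tensors makes it evident that it composes.
\<close>

definition factors_through ::
  "('k::field, 'b::ring_1) coalg \<Rightarrow> ('k, 'c::ab_group_add) coalg \<Rightarrow> (('k, 'b, 'c) tensor \<Rightarrow> 'a)
    \<Rightarrow> ('k, 'd::ab_group_add) coalg \<Rightarrow> (('k, 'b, 'd) tensor \<Rightarrow> 'a) \<Rightarrow> ('c \<Rightarrow> 'd) \<Rightarrow> bool" where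
  "factors_through B C f U \<Omega> F \<longleftrightarrow> coalgebra_map C U F \<and>
     (\<forall>b\<in>carr B. \<forall>c\<in>carr C. f (tens B C b c) = \<Omega> (tens B U b (F c)))"

lemma factors_through_ident:
  "coalgebra U \<Longrightarrow> factors_through B U \<Omega> U \<Omega> (\<lambda>x. x)"
  by (simp add: factors_through_def coalgebra_map_ident)

lemma factors_through_comp:
  assumes "coalgebra C" "coalgebra D" "coalgebra E"
    "factors_through B C f D f' F" "factors_through B D f' E f'' G"
  shows "factors_through B C f E f'' (\<lambda>c. G (F c))"
  using assms coalgebra_map_comp[OF assms(1-3)] linear_mapD(1)[OF coalgebra_mapD(1)]
  unfolding factors_through_def by fastforce

text \<open>
  Each coalgebra map agrees on the carrier with exactly one extensional function, so unique
  existence among extensional functions means existence, and uniqueness on the carrier.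
\<close>

lemma unique_factorization_iff:
  fixes B :: "('k::field, 'b::ring_1) coalg" and A :: "('k, 'a::ring_1) coalg"
    and C :: "('k, 'c::ab_group_add) coalg" and U :: "('k, 'd::ab_group_add) coalg"
  assumes A: "bialgebra A" and B: "bialgebra B" and C: "coalgebra C" and U: "coalgebra U"
    and f: "partial_covering B C A f" and \<Omega>: "partial_covering B U A \<Omega>"
  shows "(\<exists>!F. F \<in> extensional (carr C) \<and> coalgebra_map C U F \<and>
             (\<forall>t\<in>carr (tensor_space B C). f t = \<Omega> (tensor_map B C B U id F t))) \<longleftrightarrow>
    (\<exists>F. factors_through B C f U \<Omega> F) \<and>
    (\<forall>F G. factors_through B C f U \<Omega> F \<longrightarrow> factors_through B C f U \<Omega> G \<longrightarrow> (\<forall>c\<in>carr C. F c = G c))"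
    (is "?L \<longleftrightarrow> ?R")
proof -
  have lin: "linear_map (tensor_space B C) A f" "linear_map (tensor_space B U) A \<Omega>"
    using partial_covering_iff[OF A B C] partial_covering_iff[OF A B U] f \<Omega> by blast+
  have "(coalgebra_map C U F \<and> (\<forall>t\<in>carr (tensor_space B C). f t = \<Omega> (tensor_map B C B U id F t)))
      \<longleftrightarrow> factors_through B C f U \<Omega> F" for F
    unfolding factors_through_def
    using factorization_iff[OF bialgebraD(4)[OF B] coalgebraD(1)[OF C] coalgebraD(1)[OF U] bialgebraD(4)[OF A] lin]
      coalgebra_mapD(1) by blast
  hence L: "?L \<longleftrightarrow> (\<exists>!F. F \<in> extensional (carr C) \<and> factors_through B C f U \<Omega> F)" by simp
  have res: "factors_through B C f U \<Omega> (restrict F (carr C))" if "factors_through B C f U \<Omega> F" for F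
    using that coalgebra_map_cong[OF C, of "restrict F (carr C)" F U] by (simp add: factors_through_def)
  show ?thesis
    unfolding L
  proof
    assume *: "\<exists>!F. F \<in> extensional (carr C) \<and> factors_through B C f U \<Omega> F"
    have "F c = G c" if "factors_through B C f U \<Omega> F" "factors_through B C f U \<Omega> G" "c \<in> carr C" for F G c
    proof -
      have "restrict F (carr C) = restrict G (carr C)"
        using * res[OF that(1)] res[OF that(2)] by (blast intro: restrict_extensional)
      thus ?thesis using that(3) by (metis restrict_apply')
    qed
    with * show ?R by blast
  next
    assume R: ?R
    then obtain F where F: "factors_through B C f U \<Omega> F" by blast
    show "\<exists>!F. F \<in> extensional (carr C) \<and> factors_through B C f U \<Omega> F"
    proof (rule ex1I[of _ "restrict F (carr C)"])
      show "restrict F (carr C) \<in> extensional (carr C) \<and> factors_through B C f U \<Omega> (restrict F (carr C))"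
        using res[OF F] by simp
      fix G assume G: "G \<in> extensional (carr C) \<and> factors_through B C f U \<Omega> G"
      show "G = restrict F (carr C)"
        using R F G by (intro extensionalityI[of G "carr C"]) auto
    qed
  qed
qed

lemma representative_universal:
  fixes B :: "('k::field, 'b::ring_1) coalg" and A :: "('k, 'a::ring_1) coalg"
    and C :: "('k, 'c::ab_group_add) coalg"
  assumes A: "bialgebra A" and B: "bialgebra B" and C: "coalgebra C" and f: "partial_covering B C A f"
  shows "\<exists>F. factors_through B C f (representative_coalgebra B A) (representative_covering B A) F"
    and "factors_through B C f (representative_coalgebra B A) (representative_covering B A) F \<Longrightarrow>
      factors_through B C f (representative_coalgebra B A) (representative_covering B A) G \<Longrightarrow>
      c \<in> carr C \<Longrightarrow> F c = G c"
proof -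
  let ?g = "\<lambda>b c. f (tens B C b c)"
  let ?R = "representative_coalgebra B A" and ?\<Omega> = "representative_covering B A"
  have g: "covering_form B C A ?g" using partial_covering_iff[OF A B C] f by blast
  hence \<beta>: "bilinear_map B C A ?g" by (simp add: covering_form_def)
  have "factors_through B C f ?R ?\<Omega> (to_words C A ?g)"
    using to_words_coalgebra_map[OF A B C g] partial_covering_representative(2)[OF A B to_words_in_universal_carrier[OF A B C g]]
      to_words_letter(2)[OF A C \<beta> bialgebraD(2)[OF B]]
    by (simp add: factors_through_def)
  thus "\<exists>F. factors_through B C f ?R ?\<Omega> F" by blast
  have "F c = to_words C A ?g c" if F: "factors_through B C f ?R ?\<Omega> F" and c: "c \<in> carr C" for F c
  proof (rule to_words_unique[OF A B C g _ _ c])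
    show m: "coalgebra_map C ?R F" using F by (simp add: factors_through_def)
    show "?g b c = letter_value A (F c) b" if "c \<in> carr C" for b c
      using F that partial_covering_representative(2)[OF A B] linear_mapD(1)[OF coalgebra_mapD(1)[OF m] that]
      by (simp add: factors_through_def bialgebraD(2)[OF B])
  qed
  thus "F c = G c" if "factors_through B C f ?R ?\<Omega> F" "factors_through B C f ?R ?\<Omega> G" "c \<in> carr C"
    using that by simp
qed

theorem theorem2p1:
  fixes B :: "('k::field, 'b::ring_1) coalg" and A :: "('k, 'a::ring_1) coalg"
  assumes "bialgebra A" and "bialgebra B"
  shows "coalgebra (universal_covering_coalgebra B A) \<and>
    partial_covering B (universal_covering_coalgebra B A) A (universal_partial_covering B A) \<and>
    (\<forall>(C :: ('k, 'c::ab_group_add) coalg) f.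
       coalgebra C \<and> partial_covering B C A f \<longrightarrow>
       (\<exists>!F. F \<in> extensional (carr C) \<and>
             coalgebra_map C (universal_covering_coalgebra B A) F \<and>
             (\<forall>t\<in>carr (tensor_space B C).
                f t = universal_partial_covering B A
                        (tensor_map B C B (universal_covering_coalgebra B A) id F t))))"
proof -
  note A = assms(1) and B = assms(2)
  let ?R = "representative_coalgebra B A" and ?\<rho> = "representative_covering B A"
  let ?U = "universal_covering_coalgebra B A" and ?\<Omega> = "universal_partial_covering B A"
  note R = coalgebra_representative[OF A B] and \<rho> = partial_covering_representative(1)[OF A B]
  \<comment> \<open>The property by which the universal pair was chosen; it mentions only test coalgebras of functions on words.\<close>
  define P where "P = (\<lambda>(U :: ('k, ('k, 'b, 'a) words) coalg, \<Omega>). coalgebra U \<and> partial_covering B U A \<Omega> \<and>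
        (\<forall>(C :: ('k, ('k, 'b, 'a) words) coalg) f.
           coalgebra C \<and> partial_covering B C A f \<longrightarrow>
           (\<exists>!F. F \<in> extensional (carr C) \<and> coalgebra_map C U F \<and>
                 (\<forall>t\<in>carr (tensor_space B C). f t = \<Omega> (tensor_map B C B U id F t)))))"
  have "P (?R, ?\<rho>)"
    unfolding P_def prod.case
  proof (intro conjI allI impI R \<rho>, elim conjE)
    fix C :: "('k, ('k, 'b, 'a) words) coalg" and f
    assume C: "coalgebra C" and f: "partial_covering B C A f"
    show "\<exists>!F. F \<in> extensional (carr C) \<and> coalgebra_map C ?R F \<and>
                 (\<forall>t\<in>carr (tensor_space B C). f t = ?\<rho> (tensor_map B C B ?R id F t))"
      unfolding unique_factorization_iff[OF A B C R f \<rho>]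
      using representative_universal[OF A B C f] by blast
  qed
  moreover have "universal_pair B A = (SOME x. P x)" by (simp only: universal_pair_def P_def)
  ultimately have "P (universal_pair B A)" by (metis someI)
  hence P: "P (?U, ?\<Omega>)"
    by (simp add: universal_covering_coalgebra_def universal_partial_covering_def)
  note P = P[unfolded P_def prod.case]
  note U = P[THEN conjunct1] and \<Omega> = P[THEN conjunct2, THEN conjunct1]
  have words: "\<exists>F. factors_through B C f ?U ?\<Omega> F"
      "\<And>F G c. factors_through B C f ?U ?\<Omega> F \<Longrightarrow> factors_through B C f ?U ?\<Omega> G \<Longrightarrow> c \<in> carr C \<Longrightarrow> F c = G c"
    if C: "coalgebra C" and f: "partial_covering B C A f" for C :: "('k, ('k, 'b, 'a) words) coalg" and f
    using P[THEN conjunct2, THEN conjunct2, rule_format, OF conjI[OF that]]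
    unfolding unique_factorization_iff[OF A B C U f \<Omega>] by blast+
  \<comment> \<open>Two pairs that are universal for test coalgebras of functions on words are isomorphic.\<close>
  obtain G where G: "factors_through B ?R ?\<rho> ?U ?\<Omega> G" using words(1)[OF R \<rho>] by blast
  obtain H where H: "factors_through B ?U ?\<Omega> ?R ?\<rho> H" using representative_universal(1)[OF A B U \<Omega>] by blast
  have GH: "G (H x) = x" if "x \<in> carr ?U" for x
    using words(2)[OF U \<Omega> factors_through_comp[OF U R U H G] factors_through_ident[OF U] that] .
  \<comment> \<open>The isomorphism carries universality over, now for test coalgebras on any type.\<close>
  have "\<exists>!F. F \<in> extensional (carr C) \<and> coalgebra_map C ?U F \<and>
             (\<forall>t\<in>carr (tensor_space B C). f t = ?\<Omega> (tensor_map B C B ?U id F t))"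
    if C: "coalgebra C" and f: "partial_covering B C A f" for C :: "('k, 'c) coalg" and f
    unfolding unique_factorization_iff[OF A B C U f \<Omega>]
  proof (intro conjI allI impI ballI)
    obtain F where "factors_through B C f ?R ?\<rho> F" using representative_universal(1)[OF A B C f] by blast
    thus "\<exists>F. factors_through B C f ?U ?\<Omega> F" using factors_through_comp[OF C R U _ G] by blast
    fix F F' c
    assume F: "factors_through B C f ?U ?\<Omega> F" and F': "factors_through B C f ?U ?\<Omega> F'" and c: "c \<in> carr C"
    have "H (F c) = H (F' c)"
      using representative_universal(2)[OF A B C f factors_through_comp[OF C U R F H]
          factors_through_comp[OF C U R F' H] c] .
    moreover have "F c \<in> carr ?U" "F' c \<in> carr ?U"
      using F F' c linear_mapD(1)[OF coalgebra_mapD(1)] unfolding factors_through_def by blast+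
    ultimately show "F c = F' c" using GH by metis
  qed
  thus ?thesis using U \<Omega> by blast
qed

end
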